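(* Let $n>k>0$ be integers and let $L=\{\ell_1,\ell_2,\ldots,\ell_s\}\subset[0,k-1]$ with $\ell_1<\ell_2<\cdots<\ell_s$. Suppose $L$ contains $b$ full runs of consecutive integers, and let $m_i$ be the length of the $i$th full run for $1\le i\le b$. Set \[K(k,L)=\prod_{i=1}^{b}m_i!\cdot\frac{\binom{k}{k-\ell_1}\binom{k-\ell_1-1}{k-\ell_2}\cdots\binom{k-\ell_{s-1}-1}{k-\ell_s}}{\prod_{i=1}^s(\ell_i+1)(k-\ell_i)}.\] Then there is a constant $c$ depending on $k$ and $L$ but not on $n$ such that \[\vartheta(G(n,k,L))\ge K(k,L)\,n^s-cn^{s-1},\] and a constant $C$ depending on $k$ and $L$ but not on $n$ such that \[\vartheta(G(n,k,L))\le K(k,L)\,n^s+Cn^{s-1}.\] In particular, for fixed $k$ and $L$, $\vartheta(G(n,k,L))=\Theta(n^{|L|})$ as $n\to\infty$.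
   Context: For integers $a\le b$, $[a,b]=\{a,a+1,\ldots,b\}$ and $[b]=[1,b]$; $\binom{[n]}{k}$ is the family of $k$-subsets of $[n]$. For $L\subset[0,k-1]$, the generalized Johnson graph $G(n,k,L)$ has vertex set $\binom{[n]}{k}$, with $A,B$ adjacent iff $|A\cap B|\notin L$. For a graph $G$ on $N$ vertices, the Lovász number is $\vartheta(G)=\max\sum_{i,j}b_{ij}$ over all $N\times N$ positive semidefinite matrices $B=(b_{ij})$ with trace $1$ and $b_{ij}=0$ whenever $ij$ is an edge. For $L=\{\ell_1<\cdots<\ell_s\}$, a subset $\{\ell_m,\ldots,\ell_{m+p}\}$ is a run if $\ell_{m+i}=\ell_m+i$ for $0\le i\le p$; it is a full run if moreover ($m=1$ or $\ell_{m-1}<\ell_m-1$) and ($m+p=s$ or $\ell_{m+p+1}>\ell_{m+p}+1$). $L$ decomposes uniquely into full runs; the length of a run is its cardinality. *)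

theory Defs
  imports Complex_Main "HOL-Library.Landau_Symbols"
begin

text \<open>Lovasz number of a graph with finite vertex set V and adjacency relation adj:
  the supremum (attained, i.e. the maximum) of the sum of all entries of a real
  symmetric positive semidefinite V x V matrix B with trace 1 and
  B i j = 0 whenever i j is an edge.\<close>
definition psd_on :: "'a set \<Rightarrow> ('a \<Rightarrow> 'a \<Rightarrow> real) \<Rightarrow> bool" where
  "psd_on V B \<longleftrightarrow> (\<forall>i\<in>V. \<forall>j\<in>V. B i j = B j i) \<and>
     (\<forall>x :: 'a \<Rightarrow> real. 0 \<le> (\<Sum>i\<in>V. \<Sum>j\<in>V. x i * B i j * x j))"

definition lovasz_theta :: "'a set \<Rightarrow> ('a \<Rightarrow> 'a \<Rightarrow> bool) \<Rightarrow> real" where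
  "lovasz_theta V adj = Sup {(\<Sum>i\<in>V. \<Sum>j\<in>V. B i j) | B.
      psd_on V B \<and> (\<Sum>i\<in>V. B i i) = 1 \<and>
      (\<forall>i\<in>V. \<forall>j\<in>V. adj i j \<longrightarrow> B i j = 0)}"

definition johnson_vertices :: "nat \<Rightarrow> nat \<Rightarrow> nat set set" where
  "johnson_vertices n k = {A. A \<subseteq> {1..n} \<and> card A = k}"

definition johnson_adj :: "nat set \<Rightarrow> nat set \<Rightarrow> nat set \<Rightarrow> bool" where
  "johnson_adj L A B \<longleftrightarrow> A \<noteq> B \<and> card (A \<inter> B) \<notin> L"

definition theta_johnson :: "nat \<Rightarrow> nat \<Rightarrow> nat set \<Rightarrow> real" where
  "theta_johnson n k L = lovasz_theta (johnson_vertices n k) (johnson_adj L)"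

text \<open>Elements of L in increasing order, 0-based: ell L i = \<ell>_(i+1).\<close>
definition ell :: "nat set \<Rightarrow> nat \<Rightarrow> nat" where
  "ell L i = sorted_list_of_set L ! i"

text \<open>full_run L m p: {\<ell>_(m+1), ..., \<ell>_(m+p+1)} (0-based m) is a full run; its length is p+1.\<close>
definition full_run :: "nat set \<Rightarrow> nat \<Rightarrow> nat \<Rightarrow> bool" where
  "full_run L m p \<longleftrightarrow> m + p < card L \<and>
     (\<forall>i\<le>p. ell L (m + i) = ell L m + i) \<and>
     (m = 0 \<or> ell L (m - 1) + 1 < ell L m) \<and>
     (m + p + 1 = card L \<or> ell L (m + p + 1) > ell L (m + p) + 1)"

definition K_const :: "nat \<Rightarrow> nat set \<Rightarrow> real" where
  "K_const k L =
     (\<Prod>(m, p)\<in>{(m, p). full_run L m p}. fact (p + 1)) *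
     ((\<Prod>i<card L. real ((if i = 0 then k else k - ell L (i - 1) - 1) choose (k - ell L i)))
      / (\<Prod>i<card L. real (ell L i + 1) * real (k - ell L i)))"

end

theory Submission
  imports Defs "Jordan_Normal_Form.Determinant"
begin

text \<open>
  For pairs \<open>(a\<^sub>1, b\<^sub>1), \<dots>, (a\<^sub>j, b\<^sub>j)\<close> of \<open>2j\<close> distinct points, the Gram matrices of the
  vectors \<open>A \<mapsto> \<Prod>\<^sub>t (1\<^sub>A(a\<^sub>t) - 1\<^sub>A(b\<^sub>t))\<close> add up to a positive semidefinite matrix whose entry at
  \<open>A, B\<close> is, up to the factor \<open>2\<^sup>j\<close>, a polynomial \<open>Q\<^sub>j\<close> in \<open>\<bar>A \<inter> B\<bar>\<close> (a multiple of the \<open>j\<close>-th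
  primitive idempotent of the Johnson scheme). If \<open>N = 1 + \<Sum>\<^sub>j c\<^sub>j Q\<^sub>j\<close> with \<open>c\<^sub>j \<ge> 0\<close> vanishes on \<open>L\<close>,
  then \<open>N(k)\<close> bounds the Lovasz number from above. If \<open>N'\<close> is such a function for the complement \<open>L'\<close>
  of \<open>L\<close> in \<open>{0,\<dots>,k-1}\<close>, then \<open>N'\<close>, normalised to trace 1, is itself a feasible matrix, so
  \<open>(n choose k) / N'(k)\<close> bounds the Lovasz number from below. As \<open>K(k,L) K(k,L') = 1/k!\<close>, it suffices
  to find, for every \<open>L\<close>, such an \<open>N\<close> with \<open>N(k) = K(k,L) n\<^sup>s + O(n\<^sup>s\<^sup>-\<^sup>1)\<close>.

  Take \<open>c\<^sub>j\<close> supported on \<open>L + 1\<close>. Then \<open>N = 0\<close> on \<open>L\<close> is a square linear system. With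
  \<open>p(x) = \<bar>L \<inter> {0,\<dots>,x-1}\<bar>\<close> and the scaling \<open>c\<^sub>j = x\<^sub>j n\<^sup>p\<^sup>(\<^sup>j\<^sup>)\<^sup>-\<^sup>j\<close> it becomes polynomial in
  \<open>\<epsilon> = 1/n\<close>, and at \<open>\<epsilon> = 0\<close> it can be solved explicitly, one run after another: it is regular, its
  solution is positive, and the leading coefficient of \<open>N(k)\<close> comes out as \<open>K(k,L)\<close>.
  By Cramer's rule the solution for small \<open>\<epsilon>\<close> is differentiable at \<open>0\<close>, which gives the error term.
\<close>

section \<open>Semidefinite kernels on subsets and weak duality\<close>

primrec falling :: "real \<Rightarrow> nat \<Rightarrow> real" where
  "falling x 0 = 1"
| "falling x (Suc d) = x * falling (x - 1) d"

lemma psd_on_cong: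
  assumes "psd_on V M" "\<And>A B. A \<in> V \<Longrightarrow> B \<in> V \<Longrightarrow> M A B = M' A B"
  shows "psd_on V M'"
  using assms unfolding psd_on_def by simp

text \<open>Congruence by a diagonal matrix: the weights are absorbed into the test vector.\<close>

lemma psd_on_weighted:
  fixes V :: "'a set"
  assumes "psd_on V M"
  shows "psd_on V (\<lambda>A B. w A * M A B * w B)"
  unfolding psd_on_def
proof (intro conjI allI ballI)
  fix x :: "'a \<Rightarrow> real"
  have "0 \<le> (\<Sum>i\<in>V. \<Sum>j\<in>V. (x i * w i) * M i j * (x j * w j))"
    using assms unfolding psd_on_def by (elim conjE allE[of _ "\<lambda>i. x i * w i"])
  then show "0 \<le> (\<Sum>i\<in>V. \<Sum>j\<in>V. x i * (w i * M i j * w j) * x j)"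
    by (simp add: mult_ac)
qed (use assms in \<open>auto simp: psd_on_def\<close>)

lemma psd_on_sum:
  fixes V :: "'a set"
  assumes "\<And>t. t \<in> T \<Longrightarrow> psd_on V (M t)"
  shows "psd_on V (\<lambda>A B. \<Sum>t\<in>T. M t A B)"
  unfolding psd_on_def
proof (intro conjI allI ballI)
  fix x :: "'a \<Rightarrow> real"
  have "(\<Sum>i\<in>V. \<Sum>j\<in>V. x i * (\<Sum>t\<in>T. M t i j) * x j) = (\<Sum>t\<in>T. \<Sum>i\<in>V. \<Sum>j\<in>V. x i * M t i j * x j)"
    by (simp add: sum_distrib_left sum_distrib_right sum.swap[of _ T])
  also have "\<dots> \<ge> 0"
    by (rule sum_nonneg) (use assms in \<open>simp add: psd_on_def\<close>)
  finally show "0 \<le> (\<Sum>i\<in>V. \<Sum>j\<in>V. x i * (\<Sum>t\<in>T. M t i j) * x j)" .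
qed (use assms in \<open>auto simp: psd_on_def intro!: sum.cong\<close>)

lemma psd_on_sum_nonneg:
  assumes "psd_on V M"
  shows "0 \<le> (\<Sum>A\<in>V. \<Sum>B\<in>V. M A B)"
proof -
  have "0 \<le> (\<Sum>A\<in>V. \<Sum>B\<in>V. 1 * M A B * 1)"
    using assms unfolding psd_on_def by (elim conjE allE[of _ "\<lambda>_. 1"])
  then show ?thesis by simp
qed

lemma psd_on_const:
  fixes V :: "'a set"
  assumes "0 \<le> c"
  shows "psd_on V (\<lambda>_ _. c)"
  unfolding psd_on_def
proof (intro conjI allI ballI)
  fix x :: "'a \<Rightarrow> real"
  have "(\<Sum>i\<in>V. \<Sum>j\<in>V. x i * c * x j) = c * (\<Sum>i\<in>V. x i)\<^sup>2"
    by (simp add: power2_eq_square sum_product sum_distrib_left mult_ac)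
  then show "0 \<le> (\<Sum>i\<in>V. \<Sum>j\<in>V. x i * c * x j)" using assms by simp
qed auto

text \<open>Choosing each pair from what remains of \<open>U\<close> keeps the points of different
  pairs distinct. A choice with \<open>a = b\<close> contributes 0, so it needs no
  exclusion.\<close>

primrec pair_kernel :: "nat \<Rightarrow> 'a set \<Rightarrow> 'a set \<Rightarrow> 'a set \<Rightarrow> real" where
  "pair_kernel 0 U A B = 1"
| "pair_kernel (Suc j) U A B = (\<Sum>a\<in>U. \<Sum>b\<in>U.
     (of_bool (a \<in> A) - of_bool (b \<in> A)) * (of_bool (a \<in> B) - of_bool (b \<in> B))
     * pair_kernel j (U - {a, b}) A B)"

text \<open>Each chosen pair acts as a diagonal congruence with weight
  \<open>of_bool (a \<in> A) - of_bool (b \<in> A)\<close>. Carrying \<open>M\<close> through the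
  induction yields positivity of the entrywise product without the Schur product theorem.\<close>

lemma psd_on_mult_pair_kernel:
  assumes "psd_on V M"
  shows "psd_on V (\<lambda>A B. M A B * pair_kernel j U A B)"
proof (induction j arbitrary: U)
  case (Suc j)
  have "psd_on V (\<lambda>A B. \<Sum>a\<in>U. \<Sum>b\<in>U. (of_bool (a \<in> A) - of_bool (b \<in> A)) *
    (M A B * pair_kernel j (U - {a, b}) A B) * (of_bool (a \<in> B) - of_bool (b \<in> B)))"
    by (intro psd_on_sum psd_on_weighted Suc)
  then show ?case by (simp add: sum_distrib_left mult_ac)
qed (use assms in simp)

text \<open>The pair kernel in terms of the sizes \<open>x, y, u, v\<close> of \<open>A \<inter> B\<close>, \<open>- (A \<union> B)\<close>, \<open>A - B\<close>, \<open>B - A\<close>: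
  a pair contributes \<open>1\<close> if it joins the first two regions, \<open>-1\<close> if it joins the last two, and
  \<open>0\<close> otherwise.\<close>

definition pair_count :: "nat \<Rightarrow> real \<Rightarrow> real \<Rightarrow> real \<Rightarrow> real \<Rightarrow> real" where
  "pair_count j x y u v =
    2 ^ j * (\<Sum>i\<le>j. (-1) ^ i * real (j choose i) * falling x (j - i) * falling y (j - i) * falling u i * falling v i)"

lemma sum_choose_Suc:
  fixes g :: "nat \<Rightarrow> real"
  shows "(\<Sum>i\<le>Suc j. real (Suc j choose i) * g i) = (\<Sum>i\<le>j. real (j choose i) * (g i + g (Suc i)))"
proof -
  have "(\<Sum>i\<le>Suc j. real (Suc j choose i) * g i) =
     g 0 + (\<Sum>i\<le>j. (real (j choose i) + real (j choose Suc i)) * g (Suc i))"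
    by (subst sum.atMost_Suc_shift) simp
  also have "\<dots> = (\<Sum>i\<le>j. real (j choose i) * g (Suc i)) + (\<Sum>i\<le>Suc j. real (j choose i) * g i)"
    by (subst sum.atMost_Suc_shift) (simp add: distrib_right sum.distrib)
  finally show ?thesis by (simp add: distrib_left sum.distrib)
qed

text \<open>Counts by the first pair: there are \<open>2 * x * y\<close> ordered pairs of sign 1 and
  \<open>2 * u * v\<close> of sign -1, each using up one point of either region.\<close>

lemma pair_count_Suc:
  "pair_count (Suc j) x y u v =
     2 * x * y * pair_count j (x - 1) (y - 1) u v - 2 * u * v * pair_count j x y (u - 1) (v - 1)"
proof -
  define g where "g i = (-1) ^ i * falling x (Suc j - i) * falling y (Suc j - i) * falling u i * falling v i" for i
  have "pair_count (Suc j) x y u v = 2 ^ Suc j * (\<Sum>i\<le>Suc j. real (Suc j choose i) * g i)"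
    by (simp add: pair_count_def g_def mult_ac)
  also have "(\<Sum>i\<le>Suc j. real (Suc j choose i) * g i) = (\<Sum>i\<le>j. real (j choose i) * (g i + g (Suc i)))"
    by (rule sum_choose_Suc)
  also have "\<dots> = (\<Sum>i\<le>j. real (j choose i) *
      (x * y * ((-1) ^ i * falling (x - 1) (j - i) * falling (y - 1) (j - i) * falling u i * falling v i)
      - u * v * ((-1) ^ i * falling x (j - i) * falling y (j - i) * falling (u - 1) i * falling (v - 1) i)))"
    by (intro sum.cong refl) (simp add: g_def Suc_diff_le)
  finally show ?thesis
    by (simp add: pair_count_def right_diff_distrib sum_subtractf sum_distrib_left mult_ac)
qed

lemma card_Diff_singleton_real:
  "finite X \<Longrightarrow> a \<in> X \<Longrightarrow> real (card (X - {a})) = real (card X) - 1"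
  by (metis card_Suc_Diff1 of_nat_Suc add_diff_cancel_left')

lemma pair_kernel_eq:
  assumes "finite U"
  shows "pair_kernel j U A B = pair_count j (card (U \<inter> A \<inter> B)) (card (U - A - B))
     (card (U \<inter> A - B)) (card (U \<inter> B - A))"
  using assms
proof (induction j arbitrary: U)
  case 0
  then show ?case by (simp add: pair_count_def)
next
  case (Suc j)
  let ?P = "U \<inter> A \<inter> B" and ?R = "U - A - B" and ?S = "U \<inter> A - B" and ?T = "U \<inter> B - A"
  \<comment> \<open>\<open>X\<close> and \<open>Y\<close> are what remains of the kernel after a
    first pair of sign 1 or -1; they depend only on the regions met, not on the points.\<close>
  define X where "X = pair_count j (real (card ?P) - 1) (real (card ?R) - 1) (card ?S) (card ?T)"
  define Y where "Y = pair_count j (card ?P) (card ?R) (real (card ?S) - 1) (real (card ?T) - 1)"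
  have pr: "pair_kernel j (U - {a, b}) A B = X" if "a \<in> ?P" "b \<in> ?R" for a b
  proof -
    have "(U - {a, b}) \<inter> A \<inter> B = ?P - {a}" "(U - {a, b}) - A - B = ?R - {b}"
      "(U - {a, b}) \<inter> A - B = ?S" "(U - {a, b}) \<inter> B - A = ?T" using that by auto
    moreover have "real (card (?P - {a})) = real (card ?P) - 1" "real (card (?R - {b})) = real (card ?R) - 1"
      by (rule card_Diff_singleton_real; use that Suc.prems in simp)+
    ultimately show ?thesis using Suc unfolding X_def by simp
  qed
  have st: "pair_kernel j (U - {a, b}) A B = Y" if "a \<in> ?S" "b \<in> ?T" for a b
  proof -
    have "(U - {a, b}) \<inter> A \<inter> B = ?P" "(U - {a, b}) - A - B = ?R"
      "(U - {a, b}) \<inter> A - B = ?S - {a}" "(U - {a, b}) \<inter> B - A = ?T - {b}" using that by auto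
    moreover have "real (card (?S - {a})) = real (card ?S) - 1" "real (card (?T - {b})) = real (card ?T) - 1"
      by (rule card_Diff_singleton_real; use that Suc.prems in simp)+
    ultimately show ?thesis using Suc unfolding Y_def by simp
  qed
  have summand: "(of_bool (a \<in> A) - of_bool (b \<in> A)) * (of_bool (a \<in> B) - of_bool (b \<in> B))
     * pair_kernel j (U - {a, b}) A B =
     of_bool (a \<in> ?P) * of_bool (b \<in> ?R) * X + of_bool (a \<in> ?R) * of_bool (b \<in> ?P) * X
     - of_bool (a \<in> ?S) * of_bool (b \<in> ?T) * Y - of_bool (a \<in> ?T) * of_bool (b \<in> ?S) * Y"
    if "a \<in> U" "b \<in> U" for a b
    using that pr[of a b] pr[of b a] st[of a b] st[of b a]
    by (cases "a \<in> A"; cases "b \<in> A"; cases "a \<in> B"; cases "b \<in> B") (simp_all add: insert_commute)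
  have cnt: "(\<Sum>a\<in>U. \<Sum>b\<in>U. of_bool (a \<in> F) * of_bool (b \<in> G) * Z) = real (card F) * real (card G) * Z"
    if "F \<subseteq> U" "G \<subseteq> U" for F G and Z :: real
  proof -
    have c: "(\<Sum>a\<in>U. of_bool (a \<in> F) :: real) = real (card F)" if "F \<subseteq> U" for F
      using that Suc.prems by (simp add: sum.inter_restrict[symmetric] of_bool_def Int_absorb1 flip: Int_def)
    show ?thesis
      by (simp add: c that flip: sum_distrib_right sum_distrib_left sum_product)
  qed
  have sub: "?P \<subseteq> U" "?R \<subseteq> U" "?S \<subseteq> U" "?T \<subseteq> U" by auto
  have "pair_kernel (Suc j) U A B = (\<Sum>a\<in>U. \<Sum>b\<in>U.
     of_bool (a \<in> ?P) * of_bool (b \<in> ?R) * X + of_bool (a \<in> ?R) * of_bool (b \<in> ?P) * X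
     - of_bool (a \<in> ?S) * of_bool (b \<in> ?T) * Y - of_bool (a \<in> ?T) * of_bool (b \<in> ?S) * Y)"
    unfolding pair_kernel.simps by (intro sum.cong refl summand)
  also have "\<dots> = real (card ?P) * real (card ?R) * X + real (card ?R) * real (card ?P) * X
     - real (card ?S) * real (card ?T) * Y - real (card ?T) * real (card ?S) * Y"
    by (simp only: sum.distrib sum_subtractf cnt sub)
  finally have "pair_kernel (Suc j) U A B = real (card ?P) * real (card ?R) * X + real (card ?R) * real (card ?P) * X
     - real (card ?S) * real (card ?T) * Y - real (card ?T) * real (card ?S) * Y" .
  then show ?case
    unfolding pair_count_Suc X_def Y_def by simp
qed

text \<open>This is \<open>pair_count\<close> without the factor \<open>2 ^ j\<close>, at the region
  sizes of two \<open>k\<close>-sets that share \<open>x\<close> points.\<close>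

definition johnson_poly :: "nat \<Rightarrow> nat \<Rightarrow> nat \<Rightarrow> nat \<Rightarrow> real" where
  "johnson_poly n k j x = (\<Sum>i\<le>j. (-1) ^ i * real (j choose i) * falling x (j - i)
     * falling (real n - 2 * real k + real x) (j - i) * (falling (real k - real x) i)\<^sup>2)"

lemma pair_kernel_johnson:
  assumes "A \<in> johnson_vertices n k" "B \<in> johnson_vertices n k"
  shows "pair_kernel j {1..n} A B = 2 ^ j * johnson_poly n k j (card (A \<inter> B))"
proof -
  have A: "A \<subseteq> {1..n}" "card A = k" and B: "B \<subseteq> {1..n}" "card B = k"
    using assms unfolding johnson_vertices_def by auto
  have fin: "finite A" "finite B" using A B finite_subset by blast+
  have 1: "{1..n} \<inter> A \<inter> B = A \<inter> B" "{1..n} \<inter> A - B = A - B" "{1..n} \<inter> B - A = B - A"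
    "{1..n} - A - B = {1..n} - (A \<union> B)"
    using A B by auto
  have 2: "card A = card (A \<inter> B) + card (A - B)" "card B = card (A \<inter> B) + card (B - A)"
    using card_Int_Diff[OF fin(1), of B] card_Int_Diff[OF fin(2), of A] by (simp_all add: Int_commute)
  have 3: "card ({1..n} - (A \<union> B)) = n - card (A \<union> B)"
    using A B fin by (subst card_Diff_subset) auto
  have 4: "card (A \<union> B) \<le> n" using card_mono[of "{1..n}" "A \<union> B"] A B by auto
  have 5: "card A + card B = card (A \<union> B) + card (A \<inter> B)" using card_Un_Int fin by blast
  have c1: "real (card (A - B)) = real k - real (card (A \<inter> B))"
    "real (card (B - A)) = real k - real (card (A \<inter> B))"
    using 2 A B by linarith+
  have c2: "real (card ({1..n} - (A \<union> B))) = real n - 2 * real k + real (card (A \<inter> B))"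
    using 3 4 5 A B by simp
  show ?thesis
    by (subst pair_kernel_eq)
       (simp_all only: finite_atLeastAtMost 1 c1 c2 pair_count_def johnson_poly_def power2_eq_square mult.assoc)
qed

lemma psd_on_mult_johnson_poly:
  assumes "psd_on (johnson_vertices n k) M" "0 \<le> c"
  shows "psd_on (johnson_vertices n k) (\<lambda>A B. M A B * (c * johnson_poly n k j (card (A \<inter> B))))"
proof -
  \<comment> \<open>Applied on both sides, this constant weight multiplies by
    \<open>c / 2 ^ j\<close>, which cancels the factor \<open>2 ^ j\<close> of the pair
    kernel.\<close>
  let ?w = "\<lambda>_. sqrt (c / 2 ^ j)"
  have "psd_on (johnson_vertices n k) (\<lambda>A B. ?w A * (M A B * pair_kernel j {1..n} A B) * ?w B)"
    by (intro psd_on_weighted psd_on_mult_pair_kernel assms)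
  then show ?thesis
  proof (rule psd_on_cong)
    fix A B assume AB: "A \<in> johnson_vertices n k" "B \<in> johnson_vertices n k"
    have "?w A * (M A B * pair_kernel j {1..n} A B) * ?w B = (?w A * ?w B) * (M A B * pair_kernel j {1..n} A B)"
      by (simp only: mult_ac)
    also have "?w A * ?w B = c / 2 ^ j" using assms(2) by simp
    finally show "?w A * (M A B * pair_kernel j {1..n} A B) * ?w B = M A B * (c * johnson_poly n k j (card (A \<inter> B)))"
      unfolding pair_kernel_johnson[OF AB] by simp
  qed
qed

section \<open>Weak duality: bounds on the Lovasz number from both sides\<close>

definition dual_poly :: "nat \<Rightarrow> nat \<Rightarrow> nat set \<Rightarrow> (nat \<Rightarrow> real) \<Rightarrow> nat \<Rightarrow> real" where
  "dual_poly n k J c x = 1 + (\<Sum>j\<in>J. c j * johnson_poly n k j x)"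

text \<open>The entrywise product of \<open>M\<close> with each nonconstant summand is positive
  semidefinite, so its entries have a nonnegative sum.\<close>

lemma sum_le_dual_poly:
  assumes c: "\<And>j. j \<in> J \<Longrightarrow> 0 \<le> c j" and M: "psd_on (johnson_vertices n k) M"
  shows "(\<Sum>A\<in>johnson_vertices n k. \<Sum>B\<in>johnson_vertices n k. M A B) \<le>
    (\<Sum>A\<in>johnson_vertices n k. \<Sum>B\<in>johnson_vertices n k. M A B * dual_poly n k J c (card (A \<inter> B)))"
proof -
  let ?V = "johnson_vertices n k"
  have "0 \<le> (\<Sum>A\<in>?V. \<Sum>B\<in>?V. \<Sum>j\<in>J. M A B * (c j * johnson_poly n k j (card (A \<inter> B))))"
    by (intro psd_on_sum_nonneg psd_on_sum psd_on_mult_johnson_poly M c)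
  then show ?thesis
    by (simp add: dual_poly_def distrib_left sum.distrib sum_distrib_left)
qed

lemma psd_on_dual_poly:
  assumes "\<And>j. j \<in> J \<Longrightarrow> 0 \<le> c j"
  shows "psd_on (johnson_vertices n k) (\<lambda>A B. dual_poly n k J c (card (A \<inter> B)))"
proof -
  have *: "psd_on (johnson_vertices n k) (\<lambda>A B. \<Sum>j\<in>J. 1 * (c j * johnson_poly n k j (card (A \<inter> B))))"
    by (intro psd_on_sum psd_on_mult_johnson_poly psd_on_const assms) auto
  show ?thesis
    unfolding psd_on_def dual_poly_def
  proof (intro conjI allI ballI)
    fix x :: "nat set \<Rightarrow> real"
    let ?V = "johnson_vertices n k"
    have "0 \<le> (\<Sum>i\<in>?V. \<Sum>j\<in>?V. x i * 1 * x j)"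
      using psd_on_const[of 1 ?V] unfolding psd_on_def by auto
    moreover have "0 \<le> (\<Sum>A\<in>?V. \<Sum>B\<in>?V. x A * (\<Sum>j\<in>J. 1 * (c j * johnson_poly n k j (card (A \<inter> B)))) * x B)"
      using * unfolding psd_on_def by blast
    ultimately show "0 \<le> (\<Sum>A\<in>?V. \<Sum>B\<in>?V. x A * (1 + (\<Sum>j\<in>J. c j * johnson_poly n k j (card (A \<inter> B)))) * x B)"
      by (simp add: distrib_left distrib_right sum.distrib)
  qed (simp add: Int_commute)
qed

lemma finite_johnson_vertices: "finite (johnson_vertices n k)"
  unfolding johnson_vertices_def by (rule finite_subset[of _ "Pow {1..n}"]) auto

lemma card_johnson_vertices: "card (johnson_vertices n k) = n choose k"
  unfolding johnson_vertices_def using n_subsets[of "{1..n}" k] by simp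

text \<open>Off the diagonal either \<open>M\<close> vanishes (on edges) or the dual function does
  (on \<open>L\<close>), so after multiplication only the trace, weighted by the value at
  \<open>k\<close>, survives.\<close>

lemma feasible_le_dual_poly:
  assumes c: "\<And>j. j \<in> J \<Longrightarrow> 0 \<le> c j" and z: "\<And>l. l \<in> L \<Longrightarrow> dual_poly n k J c l = 0"
    and M: "psd_on (johnson_vertices n k) M" "(\<Sum>A\<in>johnson_vertices n k. M A A) = 1"
      "\<forall>A\<in>johnson_vertices n k. \<forall>B\<in>johnson_vertices n k. johnson_adj L A B \<longrightarrow> M A B = 0"
  shows "(\<Sum>A\<in>johnson_vertices n k. \<Sum>B\<in>johnson_vertices n k. M A B) \<le> dual_poly n k J c k"
proof -
  let ?V = "johnson_vertices n k"
  have "(\<Sum>A\<in>?V. \<Sum>B\<in>?V. M A B * dual_poly n k J c (card (A \<inter> B))) =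
     (\<Sum>A\<in>?V. \<Sum>B\<in>?V. if A = B then M A A * dual_poly n k J c k else 0)"
  proof (intro sum.cong refl)
    fix A B assume AB: "A \<in> ?V" "B \<in> ?V"
    show "M A B * dual_poly n k J c (card (A \<inter> B)) = (if A = B then M A A * dual_poly n k J c k else 0)"
    proof (cases "A = B")
      case True
      then show ?thesis using AB by (simp add: johnson_vertices_def)
    next
      case False
      then have "M A B = 0 \<or> dual_poly n k J c (card (A \<inter> B)) = 0"
        using M(3) z AB unfolding johnson_adj_def by blast
      then show ?thesis using False by auto
    qed
  qed
  also have "\<dots> = (\<Sum>A\<in>?V. M A A) * dual_poly n k J c k"
    by (simp add: finite_johnson_vertices sum_distrib_right)
  finally show ?thesis using sum_le_dual_poly[of J c n k M, OF c M(1)] M(2) by simp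
qed

lemma theta_johnson_le:
  assumes c: "\<And>j. j \<in> J \<Longrightarrow> 0 \<le> c j" and z: "\<And>l. l \<in> L \<Longrightarrow> dual_poly n k J c l = 0"
    and "k \<le> n"
  shows "theta_johnson n k L \<le> dual_poly n k J c k"
  unfolding theta_johnson_def lovasz_theta_def
proof (rule cSup_least)
  let ?V = "johnson_vertices n k"
  \<comment> \<open>The normalised identity matrix is feasible, so the set under the supremum is
    nonempty.\<close>
  define M where "M A B = (if A = B then 1 / real (n choose k) else 0)" for A B :: "nat set"
  have "psd_on ?V M"
    unfolding psd_on_def
  proof (intro conjI allI ballI)
    fix x :: "nat set \<Rightarrow> real"
    have "(\<Sum>A\<in>?V. \<Sum>B\<in>?V. x A * M A B * x B) = (\<Sum>A\<in>?V. (x A)\<^sup>2 / real (n choose k))"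
      unfolding M_def by (intro sum.cong refl)
        (simp add: finite_johnson_vertices if_distrib[of "\<lambda>y. _ * y"] if_distrib[of "\<lambda>y. y * _"] power2_eq_square cong: if_cong)
    then show "0 \<le> (\<Sum>A\<in>?V. \<Sum>B\<in>?V. x A * M A B * x B)" by (simp add: sum_nonneg)
  qed (auto simp: M_def)
  moreover have "(\<Sum>A\<in>?V. M A A) = 1"
    using assms(3) by (simp add: M_def card_johnson_vertices)
  moreover have "\<forall>A\<in>?V. \<forall>B\<in>?V. johnson_adj L A B \<longrightarrow> M A B = 0"
    by (simp add: M_def johnson_adj_def)
  ultimately show "{\<Sum>i\<in>?V. \<Sum>j\<in>?V. B i j |B. psd_on ?V B \<and> (\<Sum>i\<in>?V. B i i) = 1 \<and>
      (\<forall>i\<in>?V. \<forall>j\<in>?V. johnson_adj L i j \<longrightarrow> B i j = 0)} \<noteq> {}" by blast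
qed (use feasible_le_dual_poly[OF c z] in blast)

text \<open>The function for the complement of \<open>L\<close>, divided by its trace
  \<open>D\<close>, is a feasible matrix. Its total is estimated by \<open>sum_le_dual_poly\<close>
  applied to the constant matrix \<open>1 / D\<close>.\<close>

lemma theta_johnson_ge:
  assumes c: "\<And>j. j \<in> J \<Longrightarrow> 0 \<le> c j" and z: "\<And>l. l \<in> L \<Longrightarrow> dual_poly n k J c l = 0"
    and c': "\<And>j. j \<in> J' \<Longrightarrow> 0 \<le> c' j" and z': "\<And>l. l < k \<Longrightarrow> l \<notin> L \<Longrightarrow> dual_poly n k J' c' l = 0"
    and pos: "0 < dual_poly n k J' c' k" and "k \<le> n"
  shows "real (n choose k) / dual_poly n k J' c' k \<le> theta_johnson n k L"
proof -
  let ?V = "johnson_vertices n k"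
  define D where "D = real (n choose k) * dual_poly n k J' c' k"
  have D: "0 < D" using pos assms(6) by (simp add: D_def)
  define M where "M A B = dual_poly n k J' c' (card (A \<inter> B)) / D" for A B :: "nat set"
  have eq: "sqrt (1 / D) * dual_poly n k J' c' (card (A \<inter> B)) * sqrt (1 / D) = M A B" for A B :: "nat set"
    using D unfolding M_def by (simp add: real_sqrt_divide)
  have M1: "psd_on ?V M"
    using psd_on_weighted[OF psd_on_dual_poly[of J' c' n k, OF c'], of "\<lambda>_. sqrt (1 / D)"] unfolding eq .
  have "(\<Sum>A\<in>?V. M A A) = (\<Sum>A\<in>?V. dual_poly n k J' c' k / D)"
    unfolding M_def by (intro sum.cong) (auto simp: johnson_vertices_def)
  then have M2: "(\<Sum>A\<in>?V. M A A) = 1"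
    using D pos \<open>k \<le> n\<close> by (simp add: card_johnson_vertices D_def)
  have M3: "\<forall>A\<in>?V. \<forall>B\<in>?V. johnson_adj L A B \<longrightarrow> M A B = 0"
  proof (intro ballI impI)
    fix A B assume AB: "A \<in> ?V" "B \<in> ?V" "johnson_adj L A B"
    then have f: "finite A" "finite B" "card A = k" "card B = k" "A \<noteq> B"
      unfolding johnson_vertices_def johnson_adj_def by (auto intro: finite_subset)
    \<comment> \<open>Distinct \<open>k\<close>-sets meet in fewer than \<open>k\<close> points,
      which is the range where \<open>z'\<close> gives zeros.\<close>
    have "card (A \<inter> B) < k"
    proof (rule ccontr)
      assume "\<not> card (A \<inter> B) < k"
      then have "A \<inter> B = A" "A \<inter> B = B"
        using f card_seteq[of A "A \<inter> B"] card_seteq[of B "A \<inter> B"] by auto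
      then show False using f by simp
    qed
    then show "M A B = 0" using z' AB(3) unfolding M_def johnson_adj_def by simp
  qed
  have "real (n choose k) / dual_poly n k J' c' k = (\<Sum>A\<in>?V. \<Sum>B\<in>?V. 1 / D)"
    using D pos by (simp add: card_johnson_vertices D_def)
  also have "\<dots> \<le> (\<Sum>A\<in>?V. \<Sum>B\<in>?V. 1 / D * dual_poly n k J' c' (card (A \<inter> B)))"
    by (intro sum_le_dual_poly c' psd_on_const) (use D in simp_all)
  also have "\<dots> = (\<Sum>A\<in>?V. \<Sum>B\<in>?V. M A B)" by (simp add: M_def)
  also have "\<dots> \<le> theta_johnson n k L"
    unfolding theta_johnson_def lovasz_theta_def
  proof (rule cSup_upper)
    \<comment> \<open>Here the function for \<open>L\<close> itself enters: it bounds all feasible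
      values, so the supremum is meaningful.\<close>
    show "bdd_above {\<Sum>i\<in>?V. \<Sum>j\<in>?V. B i j |B. psd_on ?V B \<and> (\<Sum>i\<in>?V. B i i) = 1 \<and>
      (\<forall>i\<in>?V. \<forall>j\<in>?V. johnson_adj L i j \<longrightarrow> B i j = 0)}"
      using feasible_le_dual_poly[OF c z] by (intro bdd_aboveI[of _ "dual_poly n k J c k"]) blast
  qed (use M1 M2 M3 in blast)
  finally show ?thesis .
qed

section \<open>Runs and the constant\<close>

text \<open>The length of the run ending at \<open>x - 1\<close>, or 0 if there is none. With
  \<open>- L\<close> it measures gaps, so that runs and gaps are handled alike.\<close>

fun run_below :: "nat set \<Rightarrow> nat \<Rightarrow> nat" where
  "run_below L 0 = 0"
| "run_below L (Suc x) = (if x \<in> L then Suc (run_below L x) else 0)"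

lemma run_below_le: "run_below L x \<le> x"
  by (induction x) auto

text \<open>For \<open>x \<notin> L\<close> this is the coefficient of the leading power of \<open>n\<close> in \<open>N(x)\<close>; at \<open>x = k\<close> it is \<open>K(k,L)\<close>.
  Factorials of run lengths are built up one integer at a time, which makes the recursion local.\<close>

fun leading_const :: "nat \<Rightarrow> nat set \<Rightarrow> nat \<Rightarrow> real" where
  "leading_const k L 0 = 1"
| "leading_const k L (Suc x) =
    (if x \<in> L then leading_const k L x * real (run_below L (Suc x)) / (real (k - x))\<^sup>2
     else leading_const k L x * real (Suc x) / real (run_below (- L) (Suc x)))"

lemma leading_const_pos: "x \<le> k \<Longrightarrow> leading_const k L x > 0"
  by (induction x) (auto intro!: divide_pos_pos mult_pos_pos)

text \<open>At \<open>x = k\<close> this is \<open>K(k,L) K(k,L') = 1/k!\<close>, the reason why the two bounds meet.\<close>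

lemma leading_const_mult_compl:
  "x \<le> k \<Longrightarrow> leading_const k L x * leading_const k (- L) x = fact x * (fact (k - x) / fact k)\<^sup>2"
proof (induction x)
  case (Suc x)
  have f: "fact (k - x) = real (k - x) * fact (k - Suc x)"
    using Suc.prems fact_reduce[of "k - x", where 'a = real] by simp
  have "leading_const k L (Suc x) * leading_const k (- L) (Suc x) =
      leading_const k L x * leading_const k (- L) x * (real (Suc x) / (real (k - x))\<^sup>2)"
    by (simp add: divide_simps)
  also have "\<dots> = fact x * (fact (k - x) / fact k)\<^sup>2 * (real (Suc x) / (real (k - x))\<^sup>2)"
    using Suc by simp
  also have "\<dots> = fact (Suc x) * (fact (k - Suc x) / fact k)\<^sup>2"
    using Suc.prems unfolding f by (simp add: power_mult_distrib power_divide)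
  finally show ?case .
qed simp

lemma run_below_run:
  assumes "{a..<a + i} \<subseteq> L" "a = 0 \<or> a - 1 \<notin> L"
  shows "run_below L (a + i) = i"
  using assms
proof (induction i)
  case 0
  then show ?case by (cases a) auto
next
  case (Suc i)
  have "{a..<a + i} \<subseteq> L" "a + i \<in> L" using Suc.prems by auto
  then show ?case using Suc by simp
qed

text \<open>The \<open>i\<close>-th step through the run contributes \<open>i\<close> over the
  square of \<open>k - a - i + 1\<close>; these multiply to a factorial and a squared ratio of
  factorials.\<close>

lemma leading_const_run:
  assumes "{a..<a + m} \<subseteq> L" "a = 0 \<or> a - 1 \<notin> L" "a + m \<le> k"
  shows "leading_const k L (a + m) = leading_const k L a * fact m * (fact (k - a - m) / fact (k - a))\<^sup>2"
  using assms
proof (induction m)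
  case (Suc m)
  have r: "run_below L (a + Suc m) = Suc m"
    using run_below_run Suc.prems by blast
  have f: "fact (k - a - m) = real (k - (a + m)) * fact (k - a - Suc m)"
    using Suc.prems fact_reduce[of "k - a - m", where 'a = real] by (simp add: diff_diff_add)
  have "leading_const k L (a + Suc m) = leading_const k L (a + m) * real (Suc m) / (real (k - (a + m)))\<^sup>2"
    using r Suc.prems by auto
  also have "leading_const k L (a + m) = leading_const k L a * fact m * (fact (k - a - m) / fact (k - a))\<^sup>2"
    by (rule Suc.IH) (use Suc.prems in auto)
  finally show ?case
    using Suc.prems unfolding f by (simp add: power_mult_distrib power_divide)
qed auto

text \<open>The \<open>i\<close>-th step through the gap contributes \<open>(a + i) / i\<close>, and
  these build up a binomial coefficient.\<close>

lemma leading_const_gap: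
  assumes "{a..<a + g} \<inter> L = {}" "a = 0 \<or> a - 1 \<in> L"
  shows "leading_const k L (a + g) = leading_const k L a * real ((a + g) choose a)"
  using assms
proof (induction g)
  case (Suc g)
  have r: "run_below (- L) (a + Suc g) = Suc g"
    by (rule run_below_run) (use Suc.prems in auto)
  have "leading_const k L (a + Suc g) = leading_const k L (a + g) * real (Suc (a + g)) / real (Suc g)"
    using r Suc.prems by auto
  also have "leading_const k L (a + g) = leading_const k L a * real ((a + g) choose a)"
  proof (rule Suc.IH)
    have "{a..<a + g} \<subseteq> {a..<a + Suc g}" by auto
    then show "{a..<a + g} \<inter> L = {}" using Suc.prems(1) by blast
  qed (use Suc.prems in simp)
  also have "leading_const k L a * real ((a + g) choose a) * real (Suc (a + g)) / real (Suc g) =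
     leading_const k L a * real ((a + Suc g) choose a)"
  proof -
    have "Suc (a + g) * ((a + g) choose a) = Suc g * ((a + Suc g) choose a)"
      using Suc_times_binomial_add[of a g] Suc_times_binomial_eq[of "a + g" a]
      by (metis add_Suc_right mult.commute)
    then have "real (Suc (a + g)) * real ((a + g) choose a) = real (Suc g) * real ((a + Suc g) choose a)"
      by (metis of_nat_mult)
    then have "leading_const k L a * real ((a + g) choose a) * real (Suc (a + g)) =
       leading_const k L a * real ((a + Suc g) choose a) * real (Suc g)"
      by (metis mult.assoc mult.commute)
    then show ?thesis by (metis nonzero_eq_divide_eq of_nat_neq_0)
  qed
  finally show ?case .
qed auto

text \<open>The product defining \<open>K_const\<close>, with each run factorial spread over its run
  and each binomial rewritten by the gap below \<open>l\<close>. The additional factor on the right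
  accounts for the gap still open at \<open>x\<close>; it equals 1 at \<open>x = k\<close>.\<close>

lemma prod_choose_eq_leading_const:
  assumes "x \<le> k"
  shows "(\<Prod>l\<in>{l\<in>L. l < x}. real (run_below L (Suc l))
            * real ((k - l + run_below (- L) l) choose (k - l)) / (real (l + 1) * real (k - l)))
     = leading_const k L x * fact k * fact (run_below (- L) x) / (fact (k - x + run_below (- L) x) * fact x)"
  using assms
proof (induction x)
  case (Suc x)
  let ?g = "run_below (- L) x"
  have f: "fact (k - x) = real (k - x) * fact (k - Suc x)"
    using Suc.prems fact_reduce[of "k - x", where 'a = real] by simp
  have IH: "(\<Prod>l\<in>{l\<in>L. l < x}. real (run_below L (Suc l))
            * real ((k - l + run_below (- L) l) choose (k - l)) / (real (l + 1) * real (k - l)))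
     = leading_const k L x * fact k * fact ?g / (fact (k - x + ?g) * fact x)"
    using Suc by simp
  have nz: "real (k - x) \<noteq> 0" using Suc.prems by simp
  show ?case
  proof (cases "x \<in> L")
    case True
    have s: "{l\<in>L. l < Suc x} = insert x {l\<in>L. l < x}"
      using True by auto
    have b: "real ((k - x + ?g) choose (k - x)) = fact (k - x + ?g) / (fact (k - x) * fact ?g)"
      by (subst binomial_fact) auto
    have alg: "r * (H / (d * F * G)) / ((y + 1) * d) * (P * K * G / (H * X)) = P * r / d\<^sup>2 * K * 1 / (F * ((y + 1) * X))"
      if "d \<noteq> 0" "F \<noteq> 0" "G \<noteq> 0" "H \<noteq> 0" "X \<noteq> 0" "y + 1 \<noteq> 0" for r H d F G y P K X :: real
      using that by (simp add: power2_eq_square mult_ac)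
    have "(\<Prod>l\<in>{l\<in>L. l < Suc x}. real (run_below L (Suc l))
            * real ((k - l + run_below (- L) l) choose (k - l)) / (real (l + 1) * real (k - l)))
       = real (run_below L (Suc x)) * (fact (k - x + ?g) / (real (k - x) * fact (k - Suc x) * fact ?g))
           / ((real x + 1) * real (k - x)) * (leading_const k L x * fact k * fact ?g / (fact (k - x + ?g) * fact x))"
      unfolding s
    proof (subst prod.insert)
      show "real (run_below L (Suc x)) * real ((k - x + ?g) choose (k - x)) / (real (x + 1) * real (k - x)) *
        (\<Prod>l\<in>{l\<in>L. l < x}. real (run_below L (Suc l))
            * real ((k - l + run_below (- L) l) choose (k - l)) / (real (l + 1) * real (k - l))) =
        real (run_below L (Suc x)) * (fact (k - x + ?g) / (real (k - x) * fact (k - Suc x) * fact ?g))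
           / ((real x + 1) * real (k - x)) * (leading_const k L x * fact k * fact ?g / (fact (k - x + ?g) * fact x))"
        unfolding IH b f by (simp only: of_nat_add of_nat_1)
    qed simp_all
    also have "\<dots> = leading_const k L x * real (run_below L (Suc x)) / (real (k - x))\<^sup>2 * fact k * 1
        / (fact (k - Suc x) * ((real x + 1) * fact x))"
      by (rule alg) (use nz in auto)
    finally show ?thesis using True by (simp add: add.commute)
  next
    case False
    have s: "{l\<in>L. l < Suc x} = {l\<in>L. l < x}"
      using False less_Suc_eq by auto
    \<comment> \<open>Lengthening a gap leaves this sum unchanged, so the factorial in the
      denominator stays the same.\<close>
    have e: "k - Suc x + Suc ?g = k - x + ?g" using Suc.prems by simp
    have alg: "P * K * G / (H * X) = P * y / g * K * (g * G) / (H * (y * X))"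
      if "y \<noteq> 0" "g \<noteq> 0" for P K G H X y g :: real
      using that by simp
    have r: "run_below (- L) (Suc x) = Suc ?g" "leading_const k L (Suc x) = leading_const k L x * real (Suc x) / real (Suc ?g)"
      using False by simp_all
    show ?thesis unfolding s IH r e fact_Suc of_nat_id
      by (rule alg) simp_all
  qed
qed simp

text \<open>Along a run of length \<open>m\<close> the values are 1, ..., \<open>m\<close>, with
  product the factorial of \<open>m\<close>. Finished runs are recorded at their last element; the
  last factor belongs to a run ending at \<open>x - 1\<close>, if any.\<close>

lemma prod_run_below:
  "(\<Prod>l\<in>{l\<in>L. l < x}. real (run_below L (Suc l))) =
   (\<Prod>l\<in>{l\<in>L. Suc l < x \<and> Suc l \<notin> L}. fact (run_below L (Suc l))) * fact (run_below L x)"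
proof (induction x)
  case (Suc x)
  show ?case
  proof (cases "x \<in> L")
    case True
    have s: "{l\<in>L. l < Suc x} = insert x {l\<in>L. l < x}" using True by auto
    have t: "{l\<in>L. Suc l < Suc x \<and> Suc l \<notin> L} = {l\<in>L. Suc l < x \<and> Suc l \<notin> L}"
      using True less_Suc_eq by auto
    show ?thesis unfolding s t using Suc True
      by (subst prod.insert) (auto simp: field_simps)
  next
    case False
    have s: "{l\<in>L. l < Suc x} = {l\<in>L. l < x}" using False less_Suc_eq by auto
    show ?thesis
    proof (cases "run_below L x = 0")
      case True
      then have "{l\<in>L. Suc l < Suc x \<and> Suc l \<notin> L} = {l\<in>L. Suc l < x \<and> Suc l \<notin> L}"
        by (cases x) (auto simp: less_Suc_eq split: if_splits)
      then show ?thesis unfolding s using Suc True False by simp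
    next
      case f: False
      then obtain y where y: "x = Suc y" "y \<in> L"
        by (cases x) (auto split: if_splits)
      have "{l\<in>L. Suc l < Suc x \<and> Suc l \<notin> L} = insert y {l\<in>L. Suc l < x \<and> Suc l \<notin> L}"
        using y False by auto
      then show ?thesis unfolding s using Suc False y by simp
    qed
  qed
qed simp

section \<open>The increasing enumeration of \<open>L\<close> and its full runs\<close>

lemma ell_strict_mono:
  assumes "finite L" "i < i'" "i' < card L"
  shows "ell L i < ell L i'"
  unfolding ell_def using assms
  by (metis sorted_wrt_nth_less strict_sorted_list_of_set length_sorted_list_of_set)

lemma bij_betw_ell:
  assumes "finite L"
  shows "bij_betw (ell L) {..<card L} L"
  unfolding ell_def using assms
  by (metis bij_betw_nth distinct_sorted_list_of_set length_sorted_list_of_set set_sorted_list_of_set)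

lemma ell_in: "finite L \<Longrightarrow> i < card L \<Longrightarrow> ell L i \<in> L"
  using bij_betw_ell by (auto simp: bij_betw_def)

lemma between_ell:
  assumes "finite L" "Suc i < card L" "x \<in> L" "ell L i < x"
  shows "ell L (Suc i) \<le> x"
proof -
  obtain i' where i': "i' < card L" "x = ell L i'"
    using bij_betw_ell[OF assms(1)] assms(3) by (auto simp: bij_betw_def)
  have "i < i'"
    using ell_strict_mono[OF assms(1)] assms i' by (metis less_asym linorder_neqE_nat Suc_lessD)
  then show ?thesis
    using ell_strict_mono[OF assms(1), of "Suc i" i'] i' by (cases "i' = Suc i") auto
qed

lemma ell_0_le:
  assumes "finite L" "x \<in> L"
  shows "ell L 0 \<le> x"
proof -
  obtain i where i: "i < card L" "x = ell L i"
    using bij_betw_ell[OF assms(1)] assms(2) by (auto simp: bij_betw_def)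
  then show ?thesis using ell_strict_mono[OF assms(1), of 0 i] by (cases "i = 0") auto
qed

lemma le_ell_last:
  assumes "finite L" "Suc i = card L" "x \<in> L"
  shows "x \<le> ell L i"
proof -
  obtain i' where i': "i' < card L" "x = ell L i'"
    using bij_betw_ell[OF assms(1)] assms(3) by (auto simp: bij_betw_def)
  then show ?thesis using ell_strict_mono[OF assms(1), of i' i] assms(2) by (cases "i' = i") auto
qed

text \<open>No element of \<open>L\<close> lies between two consecutive values of
  \<open>ell\<close>, so the gap below \<open>ell L i\<close> begins right after the previous value,
  or at 0 if \<open>i = 0\<close>.\<close>

lemma run_below_ell:
  assumes "finite L" "i < card L" "ell L i < k"
  shows "(if i = 0 then k else k - ell L (i - 1) - 1) = k - ell L i + run_below (- L) (ell L i)"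
proof (cases i)
  case 0
  have "run_below (- L) (0 + ell L 0) = ell L 0"
    by (rule run_below_run) (use ell_0_le[OF assms(1)] in \<open>auto simp flip: not_le\<close>)
  then show ?thesis using 0 assms by simp
next
  case (Suc i')
  let ?a = "Suc (ell L i')"
  have lt: "ell L i' < ell L i" using ell_strict_mono assms Suc by auto
  have "run_below (- L) (?a + (ell L i - ?a)) = ell L i - ?a"
  proof (rule run_below_run)
    show "{?a..<?a + (ell L i - ?a)} \<subseteq> - L"
    proof
      fix x assume x: "x \<in> {?a..<?a + (ell L i - ?a)}"
      then have "ell L i' < x" "\<not> ell L (Suc i') \<le> x" using Suc lt by auto
      then show "x \<in> - L" using between_ell[OF assms(1), of i' x] assms(2) Suc by auto
    qed
    show "?a = 0 \<or> ?a - 1 \<notin> - L" using ell_in[OF assms(1), of i'] assms(2) Suc by simp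
  qed
  moreover have "?a + (ell L i - ?a) = ell L i" using lt by simp
  ultimately have "run_below (- L) (ell L i) = ell L i - ?a" by simp
  then show ?thesis using lt Suc assms by simp
qed

text \<open>Trades conditions on indices for conditions on membership, which can be compared with
  \<open>run_below\<close>.\<close>

lemma full_run_iff:
  assumes "finite L" "m < card L"
  shows "full_run L m p \<longleftrightarrow>
    {ell L m..ell L m + p} \<subseteq> L \<and> (ell L m = 0 \<or> ell L m - 1 \<notin> L) \<and> Suc (ell L m + p) \<notin> L"
proof
  assume f: "full_run L m p"
  have 1: "{ell L m..ell L m + p} \<subseteq> L"
  proof
    fix x assume "x \<in> {ell L m..ell L m + p}"
    then obtain i where i: "i \<le> p" "x = ell L m + i"
      by (metis add_le_cancel_left atLeastAtMost_iff le_iff_add)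
    then have "x = ell L (m + i)" "m + i < card L" using f unfolding full_run_def by auto
    then show "x \<in> L" using ell_in assms by auto
  qed
  have 2: "ell L m = 0 \<or> ell L m - 1 \<notin> L"
  proof (rule ccontr)
    assume "\<not> ?thesis"
    then have z: "0 < ell L m" and x: "ell L m - 1 \<in> L" by auto
    show False
    proof (cases m)
      case 0
      then show False using ell_0_le[OF assms(1) x] z by simp
    next
      case (Suc m')
      then have "ell L m' < ell L m - 1" using f unfolding full_run_def by auto
      from between_ell[OF assms(1) _ x this] show False using Suc assms(2) z by simp
    qed
  qed
  have 3: "Suc (ell L m + p) \<notin> L"
  proof
    assume i: "Suc (ell L m + p) \<in> L"
    have e: "ell L (m + p) = ell L m + p" using f unfolding full_run_def by auto
    show False
    proof (cases "m + p + 1 = card L")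
      case True
      then show False using le_ell_last[OF assms(1) _ i, of "m + p"] e by simp
    next
      case False
      then have "Suc (m + p) < card L" "ell L (Suc (m + p)) > Suc (ell L m + p)"
        using f e unfolding full_run_def by auto
      then show False using between_ell[OF assms(1) _ i, of "m + p"] e by simp
    qed
  qed
  show "{ell L m..ell L m + p} \<subseteq> L \<and> (ell L m = 0 \<or> ell L m - 1 \<notin> L) \<and> Suc (ell L m + p) \<notin> L"
    using 1 2 3 by blast
next
  assume a: "{ell L m..ell L m + p} \<subseteq> L \<and> (ell L m = 0 \<or> ell L m - 1 \<notin> L) \<and> Suc (ell L m + p) \<notin> L"
  \<comment> \<open>Consecutive integers in \<open>L\<close> leave no room for other elements, so
    the enumeration advances by exactly one.\<close>
  have *: "i \<le> p \<Longrightarrow> m + i < card L \<and> ell L (m + i) = ell L m + i" for i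
  proof (induction i)
    case (Suc i)
    then have IH: "m + i < card L" "ell L (m + i) = ell L m + i" by auto
    have xin: "ell L m + Suc i \<in> L" using a Suc.prems by auto
    have lt: "Suc (m + i) < card L"
    proof (rule ccontr)
      assume "\<not> Suc (m + i) < card L"
      then have "Suc (m + i) = card L" using IH by simp
      from le_ell_last[OF assms(1) this xin] IH show False by simp
    qed
    have "ell L (Suc (m + i)) \<le> ell L m + Suc i"
      using between_ell[OF assms(1) lt xin] IH by simp
    moreover have "ell L (m + i) < ell L (Suc (m + i))"
      using ell_strict_mono[OF assms(1) _ lt] by simp
    ultimately show ?case using lt IH by simp
  qed (use assms in simp)
  have 1: "m = 0 \<or> ell L (m - 1) + 1 < ell L m"
  proof (cases m)
    case (Suc m')
    then have "ell L m' < ell L m" "ell L m' \<in> L"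
      using ell_strict_mono[OF assms(1), of m' m] ell_in[OF assms(1), of m'] assms(2) by auto
    then have "ell L m' \<noteq> ell L m - 1" using a by auto
    then show ?thesis using Suc \<open>ell L m' < ell L m\<close> by simp
  qed simp
  have 2: "m + p + 1 = card L \<or> ell L (m + p + 1) > ell L (m + p) + 1"
  proof (cases "m + p + 1 = card L")
    case False
    then have lt: "m + p + 1 < card L" using *[of p] by simp
    then have "ell L (m + p) < ell L (m + p + 1)" "ell L (m + p + 1) \<in> L"
      using ell_strict_mono[OF assms(1) _ lt] ell_in[OF assms(1) lt] by auto
    moreover have "ell L (m + p) = ell L m + p" "Suc (ell L m + p) \<notin> L" using a *[of p] by auto
    ultimately show ?thesis by (metis Suc_eq_plus1 Suc_lessI)
  qed simp
  show "full_run L m p" unfolding full_run_def using * 1 2 by auto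
qed

lemma run_below_start: "run_below L x < x \<Longrightarrow> x - run_below L x - 1 \<notin> L"
  by (induction x) (auto simp: Suc_diff_le split: if_splits)

lemma run_below_subset: "{x - run_below L x..<x} \<subseteq> L"
  by (induction x) (auto simp: less_Suc_eq)

text \<open>A full run is determined by its last element \<open>l\<close>, and its length
  \<open>p + 1\<close> is read off as \<open>run_below L (Suc l)\<close>.\<close>

lemma prod_full_run:
  assumes "finite L"
  shows "(\<Prod>(m, p)\<in>{(m, p). full_run L m p}. fact (p + 1)) =
     (\<Prod>l\<in>{l\<in>L. Suc l \<notin> L}. fact (run_below L (Suc l)) :: real)"
proof -
  let ?F = "{(m, p). full_run L m p}" and ?E = "{l\<in>L. Suc l \<notin> L}"
  have run: "m < card L \<and> ell L m + p \<in> ?E \<and> run_below L (Suc (ell L m + p)) = Suc p"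
    if f: "full_run L m p" for m p
  proof -
    have m: "m < card L" using f unfolding full_run_def by auto
    note fr = f[unfolded full_run_iff[OF assms m]]
    have "run_below L (ell L m + Suc p) = Suc p"
      by (rule run_below_run) (use fr in auto)
    then show ?thesis using m fr by auto
  qed
  have inj: "inj_on (ell L) {..<card L}" and im: "ell L ` {..<card L} = L"
    using bij_betw_ell[OF assms] by (auto simp: bij_betw_def)
  have "bij_betw (\<lambda>(m, p). ell L m + p) ?F ?E"
    unfolding bij_betw_def
  proof (intro conjI equalityI subsetI)
    show "inj_on (\<lambda>(m, p). ell L m + p) ?F"
    proof (rule inj_onI, clarify)
      fix m p m' p'
      assume f: "full_run L m p" "full_run L m' p'" and e: "ell L m + p = ell L m' + p'"
      have "p = p'" using run[OF f(1)] run[OF f(2)] e by (metis Suc_inject)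
      moreover have "ell L m = ell L m'" using e calculation by simp
      ultimately show "m = m' \<and> p = p'"
        using inj run[OF f(1)] run[OF f(2)] by (auto dest: inj_onD)
    qed
  next
    fix l assume "l \<in> (\<lambda>(m, p). ell L m + p) ` ?F"
    then show "l \<in> ?E" using run by auto
  next
    fix l assume l: "l \<in> ?E"
    \<comment> \<open>The inverse map: a run of length \<open>r\<close> ending at \<open>l\<close>
      starts at \<open>Suc l - r\<close> and has \<open>p = r - 1\<close>.\<close>
    define r where "r = run_below L (Suc l)"
    have r: "0 < r" using l by (simp add: r_def)
    have rl: "r \<le> Suc l" unfolding r_def by (rule run_below_le)
    have sub: "{Suc l - r..<Suc l} \<subseteq> L" unfolding r_def by (rule run_below_subset)
    then have "Suc l - r \<in> L" using r rl by auto
    then obtain m where m: "m < card L" "ell L m = Suc l - r" using im by (metis imageE lessThan_iff)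
    have e: "ell L m + (r - 1) = l" using m r rl by simp
    have "full_run L m (r - 1)"
      unfolding full_run_iff[OF assms m(1)] e
      unfolding m(2)
      using l sub run_below_start[of L "Suc l", folded r_def] rl
      by (auto simp: atLeastLessThanSuc_atLeastAtMost)
    then show "l \<in> (\<lambda>(m, p). ell L m + p) ` ?F"
      using e by (intro image_eqI[of _ _ "(m, r - 1)"]) auto
  qed
  from prod.reindex_bij_betw[OF this, of "\<lambda>l. fact (run_below L (Suc l)) :: real"]
  have "(\<Prod>l\<in>?E. fact (run_below L (Suc l)) :: real) =
      (\<Prod>x\<in>?F. fact (run_below L (Suc (case x of (m, p) \<Rightarrow> ell L m + p))))" by simp
  also have "\<dots> = (\<Prod>(m, p)\<in>?F. fact (p + 1))"
    by (rule prod.cong[OF refl]) (use run in \<open>auto simp del: run_below.simps\<close>)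
  finally show ?thesis by simp
qed

lemma K_const_eq_leading_const:
  assumes "L \<subseteq> {..<k}"
  shows "K_const k L = leading_const k L k"
proof -
  have fin: "finite L" using assms finite_subset by blast
  have Lk: "{l\<in>L. l < k} = L" using assms by auto
  have "(\<Prod>l\<in>{l\<in>L. Suc l \<notin> L}. fact (run_below L (Suc l)) :: real) = (\<Prod>l\<in>L. real (run_below L (Suc l)))"
  proof -
    \<comment> \<open>Going one beyond \<open>k\<close> closes a run that ends at
      \<open>k - 1\<close>; since \<open>k\<close> is not in \<open>L\<close>, the leftover
      factorial is 1.\<close>
    have "(\<Prod>l\<in>{l\<in>L. l < Suc k}. real (run_below L (Suc l))) =
       (\<Prod>l\<in>{l\<in>L. Suc l < Suc k \<and> Suc l \<notin> L}. fact (run_below L (Suc l))) * fact (run_below L (Suc k))"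
      using prod_run_below[of L "Suc k"] by (simp del: run_below.simps)
    moreover have "{l\<in>L. l < Suc k} = L" "{l\<in>L. Suc l < Suc k \<and> Suc l \<notin> L} = {l\<in>L. Suc l \<notin> L}" "k \<notin> L"
      using assms by auto
    ultimately show ?thesis by simp
  qed
  then have 1: "(\<Prod>(m, p)\<in>{(m, p). full_run L m p}. fact (p + 1)) = (\<Prod>l\<in>L. real (run_below L (Suc l)))"
    using prod_full_run[OF fin] by simp
  have 2: "(\<Prod>i<card L. real ((if i = 0 then k else k - ell L (i - 1) - 1) choose (k - ell L i))) =
      (\<Prod>l\<in>L. real ((k - l + run_below (- L) l) choose (k - l)))"
  proof (subst prod.reindex_bij_betw[OF bij_betw_ell[OF fin], symmetric], rule prod.cong[OF refl])
    fix i assume "i \<in> {..<card L}"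
    then have i: "i < card L" by simp
    then have "ell L i < k" using ell_in[OF fin i] assms by auto
    then show "real ((if i = 0 then k else k - ell L (i - 1) - 1) choose (k - ell L i)) =
         real ((k - ell L i + run_below (- L) (ell L i)) choose (k - ell L i))"
      using run_below_ell[OF fin i, of k] by presburger
  qed
  have 3: "(\<Prod>i<card L. real (ell L i + 1) * real (k - ell L i)) = (\<Prod>l\<in>L. real (l + 1) * real (k - l))"
    by (rule prod.reindex_bij_betw[OF bij_betw_ell[OF fin]])
  have "K_const k L = (\<Prod>l\<in>{l\<in>L. l < k}. real (run_below L (Suc l))
            * real ((k - l + run_below (- L) l) choose (k - l)) / (real (l + 1) * real (k - l)))"
    unfolding K_const_def 1 2 3 Lk by (simp add: prod.distrib prod_dividef del: run_below.simps)
  then show ?thesis using prod_choose_eq_leading_const[of k k L] by simp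
qed

section \<open>Perturbation of linear systems\<close>

lemma differentiable_prod:
  fixes f :: "'i \<Rightarrow> real \<Rightarrow> real"
  assumes "\<And>i. i \<in> I \<Longrightarrow> f i differentiable (at z)"
  shows "(\<lambda>x. \<Prod>i\<in>I. f i x) differentiable (at z)"
  using assms by (induction I rule: infinite_finite_induct) auto

text \<open>The Leibniz formula makes the determinant a polynomial in its entries.\<close>

lemma differentiable_det:
  fixes f :: "nat \<Rightarrow> nat \<Rightarrow> real \<Rightarrow> real"
  assumes "\<And>i j. i < n \<Longrightarrow> j < n \<Longrightarrow> f i j differentiable (at z)"
  shows "(\<lambda>x. Determinant.det (mat n n (\<lambda>(i, j). f i j x))) differentiable (at z)"
proof -
  have "(\<lambda>x. \<Sum>p | p permutes {0..<n}. signof p * (\<Prod>i = 0..<n. f i (p i) x)) differentiable (at z)"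
  proof (intro differentiable_sum differentiable_mult differentiable_prod differentiable_const ballI)
    show "finite {p. p permutes {0..<n}}" by (simp add: finite_permutations)
    fix p i assume "p \<in> {p. p permutes {0..<n}}" "i \<in> {0..<n}"
    then have "i < n" "p i < n" using permutes_in_image[of p "{0..<n}" i] by auto
    then show "f i (p i) differentiable (at z)" using assms by simp
  qed
  also have "(\<lambda>x. \<Sum>p | p permutes {0..<n}. signof p * (\<Prod>i = 0..<n. f i (p i) x)) =
    (\<lambda>x. Determinant.det (mat n n (\<lambda>(i, j). f i j x)))"
  proof
    fix x
    show "(\<Sum>p | p permutes {0..<n}. signof p * (\<Prod>i = 0..<n. f i (p i) x)) =
      Determinant.det (mat n n (\<lambda>(i, j). f i j x))"
      by (subst det_def'[OF mat_carrier]) 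
         (auto intro!: sum.cong prod.cong arg_cong2[where f = "(*)"] 
           simp: permutes_in_image[of _ "{0..<n}", simplified])
  qed
  finally show ?thesis .
qed

lemma mult_mat_vec_mat:
  "i < n \<Longrightarrow> (mat n n (\<lambda>(i, j). f i j) *\<^sub>v vec n g) $ i = (\<Sum>j<n. f i j * g j :: real)"
  by (simp add: scalar_prod_def lessThan_atLeast0)

text \<open>A trivial kernel makes the determinant nonzero at \<open>z\<close>, hence near
  \<open>z\<close> by continuity. As \<open>nhds z\<close> contains \<open>z\<close>, the solution
  at \<open>z\<close> itself is covered.\<close>

lemma linear_system_perturbation:
  fixes A :: "real \<Rightarrow> nat \<Rightarrow> nat \<Rightarrow> real" and b :: "real \<Rightarrow> nat \<Rightarrow> real"
  assumes A: "\<And>i j. i < n \<Longrightarrow> j < n \<Longrightarrow> (\<lambda>e. A e i j) differentiable (at z)"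
    and b: "\<And>i. i < n \<Longrightarrow> (\<lambda>e. b e i) differentiable (at z)"
    and ker: "\<And>v j. (\<And>i. i < n \<Longrightarrow> (\<Sum>j<n. A z i j * v j) = 0) \<Longrightarrow> j < n \<Longrightarrow> v j = 0"
  obtains x where "\<And>j. j < n \<Longrightarrow> (\<lambda>e. x e j) differentiable (at z)"
    "\<forall>\<^sub>F e in nhds z. \<forall>i<n. (\<Sum>j<n. A e i j * x e j) = b e i"
proof -
  define M where "M e = mat n n (\<lambda>(i, j). A e i j)" for e
  define D where "D e = Determinant.det (M e)" for e
  \<comment> \<open>Cramer's quotients; they are differentiable at \<open>z\<close> because
    \<open>D z\<close> will turn out to be nonzero.\<close>
  define x where "x e j = Determinant.det (mat n n (\<lambda>(i, j'). if j' = j then b e i else A e i j')) / D e" for e j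
  have M: "M e \<in> carrier_mat n n" for e unfolding M_def by simp
  have Dd: "D differentiable (at z)"
    unfolding D_def M_def using differentiable_det[of n "\<lambda>i j e. A e i j"] A by simp
  have Dz: "D z \<noteq> 0"
  proof
    assume "D z = 0"
    then obtain v where v: "v \<in> carrier_vec n" "v \<noteq> 0\<^sub>v n" "M z *\<^sub>v v = 0\<^sub>v n"
      unfolding D_def using det_0_iff_vec_prod_zero_field[OF M] by auto
    have vv: "v = vec n (\<lambda>i. v $ i)" using v by auto
    have "(\<Sum>j<n. A z i j * v $ j) = 0" if "i < n" for i
      using mult_mat_vec_mat[OF that, of "A z" "\<lambda>i. v $ i"] v(3) vv that unfolding M_def by simp
    then have "v $ j = 0" if "j < n" for j using ker[of "\<lambda>i. v $ i"] that by blast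
    then have "v = 0\<^sub>v n" using v by auto
    then show False using v by simp
  qed
  have "isCont D z" using Dd by (auto simp: real_differentiable_def DERIV_isCont)
  then have "(D \<longlongrightarrow> D z) (nhds z)" by (simp add: tendsto_nhds_iff isCont_def)
  then have ev: "\<forall>\<^sub>F e in nhds z. D e \<noteq> 0"
    using Dz by (rule tendsto_imp_eventually_ne)
  show ?thesis
  proof
    fix j assume j: "j < n"
    show "(\<lambda>e. x e j) differentiable (at z)"
      unfolding x_def
    proof (intro differentiable_divide Dd Dz differentiable_det[of n "\<lambda>i j' e. if j' = j then b e i else A e i j'"])
      fix i j' assume "i < n" "j' < n"
      then show "(\<lambda>e. if j' = j then b e i else A e i j') differentiable (at z)"
        using A b by (cases "j' = j") auto
    qed
  next
    show "\<forall>\<^sub>F e in nhds z. \<forall>i<n. (\<Sum>j<n. A e i j * x e j) = b e i"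
      using ev
    proof eventually_elim
      fix e assume De: "D e \<noteq> 0"
      then obtain B where B: "B \<in> carrier_mat n n" "M e * B = 1\<^sub>m n"
        using det_non_zero_imp_unit[OF M[of e], of "()"] unfolding D_def Units_def
        by (auto simp: ring_mat_def)
      \<comment> \<open>The inverse supplies some solution \<open>y\<close>; Cramer's rule then
        identifies it with \<open>x e\<close>.\<close>
      define y where "y = B *\<^sub>v vec n (b e)"
      have y: "y \<in> carrier_vec n" "M e *\<^sub>v y = vec n (b e)"
        using B M[of e] by (auto simp: y_def simp flip: assoc_mult_mat_vec)
      have "y $ j = x e j" if "j < n" for j
      proof -
        have "replace_col (M e) (vec n (b e)) j = mat n n (\<lambda>(i, j'). if j' = j then b e i else A e i j')"
          unfolding replace_col_def M_def by auto
        then show ?thesis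
          using cramer_lemma_mat[OF M[of e] y(1) that] De unfolding y(2) x_def D_def by (simp add: field_simps)
      qed
      then have "y = vec n (x e)" using y(1) by auto
      then show "\<forall>i<n. (\<Sum>j<n. A e i j * x e j) = b e i"
        using y(2) mult_mat_vec_mat[of _ n "A e" "x e"] unfolding M_def by auto
    qed
  qed
qed

section \<open>The limit of the dual linear system\<close>

lemma falling_eq_prod: "falling x d = (\<Prod>t<d. x - real t)"
  by (induction d arbitrary: x) (simp_all add: prod.lessThan_Suc_shift diff_diff_eq add.commute del: prod.lessThan_Suc)

lemma falling_of_nat: "d \<le> m \<Longrightarrow> falling (real m) d = fact m / fact (m - d)"
proof (induction d arbitrary: m)
  case (Suc d)
  then obtain m' where m: "m = Suc m'" by (cases m) auto
  then show ?case using Suc by simp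
qed simp

lemma falling_eq_0: "m < d \<Longrightarrow> falling (real m) d = 0"
  unfolding falling_eq_prod by auto

text \<open>The function \<open>p\<close> of the outline: \<open>N(x)\<close> is measured against
  this power of \<open>n\<close>.\<close>

definition rank_below :: "nat set \<Rightarrow> nat \<Rightarrow> nat" where
  "rank_below L x = card (L \<inter> {..<x})"

lemma rank_below_add: "rank_below L (x + d) = rank_below L x + card (L \<inter> {x..<x + d})"
proof -
  have "L \<inter> {..<x + d} = (L \<inter> {..<x}) \<union> (L \<inter> {x..<x + d})" by auto
  then show ?thesis unfolding rank_below_def by (simp add: card_Un_disjoint disjoint_iff)
qed

lemma rank_below_add_le: "rank_below L (x + d) \<le> rank_below L x + d"
  using card_mono[of "{x..<x + d}" "L \<inter> {x..<x + d}"] by (simp add: rank_below_add)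

text \<open>Equality in the rank bounds decides which entries of the scaled system survive at
  \<open>e = 0\<close>.\<close>

lemma rank_below_add_eq_iff: "rank_below L (x + d) = rank_below L x + d \<longleftrightarrow> {x..<x + d} \<subseteq> L"
proof -
  have "card (L \<inter> {x..<x + d}) = d \<longleftrightarrow> L \<inter> {x..<x + d} = {x..<x + d}"
    using card_subset_eq[of "{x..<x + d}" "L \<inter> {x..<x + d}"] by auto
  then show ?thesis by (auto simp: rank_below_add)
qed

lemma rank_below_add_same_iff: "rank_below L (x + d) = rank_below L x \<longleftrightarrow> L \<inter> {x..<x + d} = {}"
  by (simp add: rank_below_add)

lemma rank_below_mono: "x \<le> y \<Longrightarrow> rank_below L x \<le> rank_below L y"
  using rank_below_add[of L x "y - x"] by simp

lemma rank_below_eq_0_iff: "rank_below L x = 0 \<longleftrightarrow> L \<inter> {..<x} = {}"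
  unfolding rank_below_def by simp

text \<open>The coefficient \<open>Q\<^sub>j(l) n\<^sup>p\<^sup>(\<^sup>j\<^sup>)\<^sup>-\<^sup>j\<^sup>-\<^sup>p\<^sup>(\<^sup>l\<^sup>)\<close> of the scaled system, at \<open>e = 1/n\<close>. The difference in the
  exponent of \<open>e\<close> is truncated only in terms with \<open>falling l (j - i) = 0\<close>.\<close>

definition scaled_entry :: "nat \<Rightarrow> nat set \<Rightarrow> nat \<Rightarrow> nat \<Rightarrow> real \<Rightarrow> real" where
  "scaled_entry k L l j e = (\<Sum>i\<le>j. (-1) ^ i * real (j choose i) * falling l (j - i)
     * (\<Prod>t<j - i. 1 - (2 * real k - real l + real t) * e) * (falling (real k - real l) i)\<^sup>2
     * e ^ (i + rank_below L l - rank_below L j))"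

text \<open>Each of the \<open>j - i\<close> factors of the falling factorial containing
  \<open>n\<close> releases one \<open>n\<close> and leaves a polynomial in
  \<open>1 / n\<close>.\<close>

lemma johnson_poly_eq_scaled_entry:
  assumes "0 < n"
  shows "johnson_poly n k j l * real n ^ rank_below L j = scaled_entry k L l j (1 / n) * real n ^ (j + rank_below L l)"
  unfolding johnson_poly_def scaled_entry_def sum_distrib_right
proof (rule sum.cong[OF refl])
  fix i assume "i \<in> {..j}"
  then have i: "i \<le> j" by simp
  let ?rj = "rank_below L j" and ?rl = "rank_below L l"
  let ?F = "falling (real n - 2 * real k + real l) (j - i)"
  let ?P = "\<Prod>t<j - i. 1 - (2 * real k - real l + real t) * (1 / n)"
  show "(-1) ^ i * real (j choose i) * falling l (j - i) * ?F * (falling (real k - real l) i)\<^sup>2 * real n ^ ?rj =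
    (-1) ^ i * real (j choose i) * falling l (j - i) * ?P * (falling (real k - real l) i)\<^sup>2
     * (1 / n) ^ (i + ?rl - ?rj) * real n ^ (j + ?rl)"
  proof (cases "l < j - i")
    case True
    then show ?thesis by (simp add: falling_eq_0)
  next
    case False
    \<comment> \<open>A nonzero term has \<open>j \<le> l + i\<close>, and the rank grows by at most
      1 per integer, so the exponent is not truncated.\<close>
    have "?rj \<le> ?rl + i"
      using rank_below_mono[of j "l + i" L] rank_below_add_le[of L l i] False by linarith
    then obtain d where d: "?rl + i = ?rj + d" using le_iff_add by blast
    then have "i + ?rl - ?rj = d" "j + ?rl = (j - i) + ?rj + d" using i by simp_all
    then have e: "(1 / real n) ^ (i + ?rl - ?rj) * real n ^ (j + ?rl) = real n ^ (j - i) * real n ^ ?rj"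
      using assms by (simp only: power_add power_one_over) simp
    have "?F = (\<Prod>t<j - i. real n * (1 - (2 * real k - real l + real t) * (1 / n)))"
      unfolding falling_eq_prod using assms by (intro prod.cong refl) (simp add: field_simps)
    also have "\<dots> = real n ^ (j - i) * ?P" by (simp add: prod.distrib)
    finally have F: "?F = real n ^ (j - i) * ?P" .
    show ?thesis unfolding F using e by (simp add: mult_ac)
  qed
qed

text \<open>Here the rank of \<open>l\<close> is at least that of \<open>j\<close>, so the power of
  \<open>e\<close> is trivial only for \<open>i = 0\<close> and equal ranks.\<close>

lemma scaled_entry_0_ge:
  assumes "j \<le> l"
  shows "scaled_entry k L l j 0 = (if L \<inter> {j..<l} = {} then falling l j else 0)"
proof -
  have r: "rank_below L j \<le> rank_below L l" using assms by (rule rank_below_mono)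
  have "scaled_entry k L l j 0 = (\<Sum>i\<le>j. if i = 0 then of_bool (rank_below L l = rank_below L j) * falling l j else 0)"
    unfolding scaled_entry_def using r by (intro sum.cong refl) auto
  also have "\<dots> = of_bool (rank_below L l = rank_below L j) * falling l j"
    by simp
  finally show ?thesis using rank_below_add_same_iff[of L j "l - j"] assms by simp
qed

text \<open>For \<open>i < d\<close> the falling factorial of \<open>l\<close> vanishes, for
  \<open>i > d\<close> a positive power of \<open>e\<close> remains; \<open>i = d\<close> survives
  exactly when the rank rises by \<open>d\<close>.\<close>

lemma scaled_entry_0_le:
  assumes "l + d \<le> k"
  shows "scaled_entry k L l (l + d) 0 = (if {l..<l + d} \<subseteq> L
    then (-1) ^ d * fact (l + d) / fact d * (fact (k - l) / fact (k - l - d))\<^sup>2 else 0)"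
proof -
  let ?rj = "rank_below L (l + d)" and ?rl = "rank_below L l"
  have r: "?rj \<le> ?rl + d" by (rule rank_below_add_le)
  have "scaled_entry k L l (l + d) 0 = (\<Sum>i\<le>l + d. if i = d then of_bool (?rj = ?rl + d) *
     ((-1) ^ d * real ((l + d) choose d) * falling l l * (falling (real k - real l) d)\<^sup>2) else 0)"
    unfolding scaled_entry_def
  proof (intro sum.cong refl)
    fix i assume i: "i \<in> {..l + d}"
    show "(-1) ^ i * real ((l + d) choose i) * falling l (l + d - i)
     * (\<Prod>t<l + d - i. 1 - (2 * real k - real l + real t) * 0) * (falling (real k - real l) i)\<^sup>2
     * 0 ^ (i + ?rl - ?rj) = (if i = d then of_bool (?rj = ?rl + d) *
     ((-1) ^ d * real ((l + d) choose d) * falling l l * (falling (real k - real l) d)\<^sup>2) else 0)"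
    proof (cases i d rule: linorder_cases)
      case less
      then have "falling l (l + d - i) = 0" by (intro falling_eq_0) simp
      then show ?thesis using less by simp
    qed (use r in auto)
  qed
  also have "\<dots> = of_bool (?rj = ?rl + d) *
     ((-1) ^ d * real ((l + d) choose d) * falling l l * (falling (real k - real l) d)\<^sup>2)" by simp
  also have "falling l l = fact l" by (simp add: falling_of_nat)
  also have "falling (real k - real l) d = fact (k - l) / fact (k - l - d)"
    using falling_of_nat[of d "k - l"] assms by (simp add: of_nat_diff)
  also have "real ((l + d) choose d) = fact (l + d) / (fact d * fact l)"
    by (subst binomial_fact) auto
  finally show ?thesis unfolding rank_below_add_eq_iff by simp
qed

text \<open>The sum has at most one term, coming from the largest element of \<open>L\<close> below \<open>x\<close>.\<close>

definition pred_term :: "nat set \<Rightarrow> (nat \<Rightarrow> real) \<Rightarrow> nat \<Rightarrow> real" where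
  "pred_term L v x = (\<Sum>c\<in>{c\<in>L. c < x \<and> L \<inter> {Suc c..<x} = {}}. falling x (Suc c) * v c)"

lemma pred_term_eq:
  assumes "c \<in> L" "c < x" "L \<inter> {Suc c..<x} = {}"
  shows "pred_term L v x = fact x / fact (x - Suc c) * v c"
proof -
  have "{c\<in>L. c < x \<and> L \<inter> {Suc c..<x} = {}} = {c}"
    using assms by (auto simp: set_eq_iff) (metis Suc_leI linorder_neqE_nat)+
  then show ?thesis unfolding pred_term_def using assms falling_of_nat[of "Suc c" x] by simp
qed

lemma pred_term_0: "L \<inter> {..<x} = {} \<Longrightarrow> pred_term L v x = 0"
  unfolding pred_term_def by (rule sum.neutral) auto

text \<open>Column \<open>c\<close> belongs to the index \<open>Suc c\<close>. Columns below
  \<open>l\<close> reduce to the predecessor of \<open>l\<close>; of the others, only those in the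
  same run survive.\<close>

lemma row_0:
  assumes L: "L \<subseteq> {..<k}" and run: "{l..<b} \<subseteq> L" "b \<notin> L" "l \<le> b" "b \<le> k"
  shows "(\<Sum>c\<in>L. scaled_entry k L l (Suc c) 0 * v c) = pred_term L v l +
    (\<Sum>c\<in>{l..<b}. (-1) ^ (Suc c - l) * fact (Suc c) / fact (Suc c - l)
        * (fact (k - l) / fact (k - Suc c))\<^sup>2 * v c)"
proof -
  have fin: "finite L" using L finite_subset by blast
  have "(\<Sum>c\<in>L. scaled_entry k L l (Suc c) 0 * v c) =
     (\<Sum>c\<in>{c\<in>L. c < l}. scaled_entry k L l (Suc c) 0 * v c) + (\<Sum>c\<in>{c\<in>L. \<not> c < l}. scaled_entry k L l (Suc c) 0 * v c)"
    by (subst sum.union_disjoint[symmetric]) (use fin in \<open>auto intro!: sum.cong\<close>)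
  also have "(\<Sum>c\<in>{c\<in>L. c < l}. scaled_entry k L l (Suc c) 0 * v c) = pred_term L v l"
    unfolding pred_term_def
    by (rule sum.mono_neutral_cong_right) (use fin in \<open>auto simp: scaled_entry_0_ge\<close>)
  also have "(\<Sum>c\<in>{c\<in>L. \<not> c < l}. scaled_entry k L l (Suc c) 0 * v c) =
     (\<Sum>c\<in>{l..<b}. (-1) ^ (Suc c - l) * fact (Suc c) / fact (Suc c - l)
        * (fact (k - l) / fact (k - Suc c))\<^sup>2 * v c)"
  proof (rule sum.mono_neutral_cong_right)
    show "\<forall>i\<in>{c \<in> L. \<not> c < l} - {l..<b}. scaled_entry k L l (Suc i) 0 * v i = 0"
    proof
      fix c assume c: "c \<in> {c \<in> L. \<not> c < l} - {l..<b}"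
      then have "b \<in> {l..<l + (Suc c - l)}" "l + (Suc c - l) = Suc c" "Suc c \<le> k"
        using L run(3) by auto
      moreover from this have "\<not> {l..<l + (Suc c - l)} \<subseteq> L" using run(2) by blast
      ultimately show "scaled_entry k L l (Suc c) 0 * v c = 0"
        using scaled_entry_0_le[of l "Suc c - l" k L] by simp
    qed
  next
    fix c assume c: "c \<in> {l..<b}"
    then have 1: "l + (Suc c - l) = Suc c" "Suc c \<le> k" "k - l - (Suc c - l) = k - Suc c" using run by auto
    have "{l..<Suc c} \<subseteq> L" using c run(1) by auto
    then show "scaled_entry k L l (Suc c) 0 * v c = (-1) ^ (Suc c - l) * fact (Suc c) / fact (Suc c - l)
        * (fact (k - l) / fact (k - Suc c))\<^sup>2 * v c"
      using scaled_entry_0_le[of l "Suc c - l" k L, unfolded 1] 1(2) by simp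
  qed (use fin run in auto)
  finally show ?thesis .
qed

text \<open>The binomial expansion of \<open>(1 - 1) ^ (m - h)\<close>, divided by the factorial of
  \<open>m - h\<close>.\<close>

lemma alternating_fact_sum:
  assumes "h < m"
  shows "(\<Sum>i\<in>{h..m}. (-1) ^ (i - h) / (fact (i - h) * fact (m - i)) :: real) = 0"
proof -
  let ?d = "m - h"
  have "(\<Sum>i\<in>{h..m}. (-1) ^ (i - h) / (fact (i - h) * fact (m - i)) :: real) =
     (\<Sum>t\<le>?d. (-1) ^ t * real (?d choose t) / fact ?d)"
  proof (rule sum.reindex_bij_witness[where i = "\<lambda>t. h + t" and j = "\<lambda>i. i - h"])
    fix i assume i: "i \<in> {h..m}"
    then have "real (?d choose (i - h)) = fact ?d / (fact (i - h) * fact (?d - (i - h)))"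
      by (intro binomial_fact) auto
    moreover have "?d - (i - h) = m - i" using i by auto
    ultimately show "(-1) ^ (i - h) * real (?d choose (i - h)) / fact ?d =
      (-1) ^ (i - h) / (fact (i - h) * fact (m - i))" by simp
  qed (use assms in auto)
  also have "\<dots> = (\<Sum>t\<le>?d. (-1) ^ t * real (?d choose t)) / fact ?d"
    by (rule sum_divide_distrib[symmetric])
  also have "(\<Sum>t\<le>?d. (-1) ^ t * real (?d choose t)) = 0"
    using choose_alternating_sum[of ?d, where 'a = real] assms by simp
  finally show ?thesis by simp
qed

text \<open>The equations are triangular, so \<open>y m\<close> determines the rest by downward
  induction; the asserted values fit because of \<open>alternating_fact_sum\<close>.\<close>

lemma alternating_back_substitution:
  fixes y :: "nat \<Rightarrow> real"
  assumes "\<And>h. 1 \<le> h \<Longrightarrow> h < m \<Longrightarrow> (\<Sum>i\<in>{h..m}. (-1) ^ (i - h) / fact (i - h) * y i) = 0"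
    and "1 \<le> i" "i \<le> m"
  shows "y i = y m / fact (m - i)"
  using assms(2,3)
proof (induction "m - i" arbitrary: i rule: less_induct)
  case less
  show ?case
  proof (cases "i = m")
    case False
    then have im: "i < m" using less by simp
    have s: "{i..m} = insert i {Suc i..m}" using im by auto
    have "(\<Sum>j\<in>{Suc i..m}. (-1) ^ (j - i) / fact (j - i) * y j) =
       (\<Sum>j\<in>{Suc i..m}. (-1) ^ (j - i) / (fact (j - i) * fact (m - j))) * y m"
      unfolding sum_distrib_right
    proof (intro sum.cong refl)
      fix j assume "j \<in> {Suc i..m}"
      then have "m - j < m - i" "1 \<le> j" "j \<le> m" by auto
      then have "y j = y m / fact (m - j)" by (rule less.hyps)
      then show "(-1) ^ (j - i) / fact (j - i) * y j = (-1) ^ (j - i) / (fact (j - i) * fact (m - j)) * y m"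
        by simp
    qed
    moreover have "(\<Sum>j\<in>{i..m}. (-1) ^ (j - i) / fact (j - i) * y j) = 0"
      by (rule assms(1)) (use less.prems im in auto)
    moreover have "(\<Sum>j\<in>{i..m}. (-1) ^ (j - i) / (fact (j - i) * fact (m - j)) :: real) = 0"
      by (rule alternating_fact_sum[OF im])
    ultimately have "y i + (\<Sum>j\<in>{Suc i..m}. (-1) ^ (j - i) / (fact (j - i) * fact (m - j))) * y m = 0"
      "1 / fact (m - i) + (\<Sum>j\<in>{Suc i..m}. (-1) ^ (j - i) / (fact (j - i) * fact (m - j)) :: real) = 0"
      unfolding s by simp_all
    then have "(\<Sum>j\<in>{Suc i..m}. (-1) ^ (j - i) / (fact (j - i) * fact (m - j)) :: real) = - (1 / fact (m - i))"
      "y i + (\<Sum>j\<in>{Suc i..m}. (-1) ^ (j - i) / (fact (j - i) * fact (m - j))) * y m = 0"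
      by linarith+
    then show ?thesis by (simp only:) simp
  qed simp
qed

text \<open>After substituting the solution, this is the vanishing alternating sum for
  \<open>h = 0\<close> without its term \<open>i = 0\<close>.\<close>

lemma alternating_total:
  fixes y :: "nat \<Rightarrow> real"
  assumes "\<And>h. 1 \<le> h \<Longrightarrow> h < m \<Longrightarrow> (\<Sum>i\<in>{h..m}. (-1) ^ (i - h) / fact (i - h) * y i) = 0"
    and "1 \<le> m"
  shows "(\<Sum>i\<in>{1..m}. (-1) ^ i / fact i * y i) = - (y m / fact m)"
proof -
  have s: "{0..m} = insert 0 {1..m}" by auto
  have "(\<Sum>i\<in>{1..m}. (-1) ^ i / fact i * y i) = (\<Sum>i\<in>{1..m}. (-1) ^ i / (fact i * fact (m - i))) * y m"
    unfolding sum_distrib_right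
  proof (intro sum.cong refl)
    fix i assume "i \<in> {1..m}"
    then have "y i = y m / fact (m - i)" using alternating_back_substitution[of m y i] assms(1) by auto
    then show "(-1) ^ i / fact i * y i = (-1) ^ i / (fact i * fact (m - i)) * y m" by simp
  qed
  also have "(\<Sum>i\<in>{1..m}. (-1) ^ i / (fact i * fact (m - i)) :: real) = - (1 / fact m)"
  proof -
    have "1 / fact m + (\<Sum>i\<in>{1..m}. (-1) ^ i / (fact i * fact (m - i)) :: real) = 0"
      using alternating_fact_sum[of 0 m] assms(2) unfolding s by simp
    then show ?thesis by linarith
  qed
  finally show ?thesis by simp
qed

text \<open>The limit of the scaled \<open>N(x)\<close> as far as the constant term and the unknowns
  below \<open>x\<close> determine it. The parameter allows treating the homogeneous system (0) and
  the actual one (1) together.\<close>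

definition partial_value :: "real \<Rightarrow> nat set \<Rightarrow> (nat \<Rightarrow> real) \<Rightarrow> nat \<Rightarrow> real" where
  "partial_value \<beta> L v x = \<beta> * of_bool (rank_below L x = 0) + pred_term L v x"

text \<open>On a run \<open>{a..<a + m}\<close> the rescaled unknowns \<open>y i\<close> satisfy alternating equations with coefficients
  \<open>1 / fact (i - h)\<close>; only the row \<open>a\<close> involves the solution below the run.\<close>

lemma run_solution:
  assumes L: "L \<subseteq> {..<k}" and run: "{a..<a + m} \<subseteq> L" "a + m \<notin> L" "a = 0 \<or> a - 1 \<notin> L"
    and eqs: "\<And>l. l \<in> L \<Longrightarrow> (\<Sum>c\<in>L. scaled_entry k L l (Suc c) 0 * v c) = - \<beta> * of_bool (rank_below L l = 0)"
    and i: "1 \<le> i" "i \<le> m"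
  shows "v (a + i - 1) = partial_value \<beta> L v a * fact m * (fact (k - a - i) / fact (k - a))\<^sup>2
    / (fact (a + i) * fact (m - i))"
proof -
  have mk: "a + m \<le> k"
  proof -
    have "a + m - 1 \<in> L" using run i by auto
    then show ?thesis using L i by auto
  qed
  define y where "y i = v (a + i - 1) * fact (a + i) / (fact (k - a - i))\<^sup>2" for i
  have row: "(\<Sum>c\<in>L. scaled_entry k L (a + h) (Suc c) 0 * v c) = pred_term L v (a + h) +
    (fact (k - a - h))\<^sup>2 * (\<Sum>i\<in>{Suc h..m}. (-1) ^ (i - h) / fact (i - h) * y i)" if "h < m" for h
  proof -
    have "{a + h..<a + m} \<subseteq> L" using run by auto
    from row_0[OF L this run(2) _ mk, of v] that
    have "(\<Sum>c\<in>L. scaled_entry k L (a + h) (Suc c) 0 * v c) = pred_term L v (a + h) +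
    (\<Sum>c\<in>{a + h..<a + m}. (-1) ^ (Suc c - (a + h)) * fact (Suc c) / fact (Suc c - (a + h))
        * (fact (k - (a + h)) / fact (k - Suc c))\<^sup>2 * v c)" by simp
    also have "(\<Sum>c\<in>{a + h..<a + m}. (-1) ^ (Suc c - (a + h)) * fact (Suc c) / fact (Suc c - (a + h))
        * (fact (k - (a + h)) / fact (k - Suc c))\<^sup>2 * v c) =
      (\<Sum>i\<in>{Suc h..m}. (fact (k - a - h))\<^sup>2 * ((-1) ^ (i - h) / fact (i - h) * y i))"
      by (rule sum.reindex_bij_witness[where i = "\<lambda>i. a + i - 1" and j = "\<lambda>c. Suc c - a"])
         (auto simp: y_def power_divide diff_diff_add)
    finally show ?thesis by (simp add: sum_distrib_left)
  qed
  \<comment> \<open>Inside the run, the predecessor term of row \<open>a + h\<close> supplies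
    precisely the summand \<open>i = h\<close> missing from \<open>row\<close>.\<close>
  have inner: "(\<Sum>i\<in>{h..m}. (-1) ^ (i - h) / fact (i - h) * y i) = 0" if h: "1 \<le> h" "h < m" for h
  proof -
    have "a + h - 1 \<in> {a..<a + m}" using h by auto
    then have c: "a + h - 1 \<in> L" using run(1) by blast
    have "pred_term L v (a + h) = fact (a + h) / fact (a + h - Suc (a + h - 1)) * v (a + h - 1)"
      by (rule pred_term_eq) (use c h in auto)
    then have p: "pred_term L v (a + h) = (fact (k - a - h))\<^sup>2 * y h"
      using h by (simp add: y_def)
    have "rank_below L (a + h) \<noteq> 0" using c h by (auto simp: rank_below_eq_0_iff)
    moreover have "a + h \<in> L" using run h by auto
    ultimately have "(fact (k - a - h))\<^sup>2 * (y h + (\<Sum>i\<in>{Suc h..m}. (-1) ^ (i - h) / fact (i - h) * y i)) = 0"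
      using row[OF h(2)] eqs[of "a + h"] p by (simp add: distrib_left)
    moreover have "{h..m} = insert h {Suc h..m}" using h by auto
    ultimately show ?thesis by simp
  qed
  have m: "1 \<le> m" using i by simp
  have "a \<in> L" using run m by auto
  then have "pred_term L v a + (fact (k - a))\<^sup>2 * (- (y m / fact m)) = - \<beta> * of_bool (rank_below L a = 0)"
    using row[of 0] eqs[of a] alternating_total[of m y] inner m by simp
  then have "partial_value \<beta> L v a = (fact (k - a))\<^sup>2 * (y m / fact m)"
    unfolding partial_value_def by simp
  then have ym: "y m = partial_value \<beta> L v a * fact m / (fact (k - a))\<^sup>2"
    by (simp add: field_simps)
  have "y i = y m / fact (m - i)"
    using alternating_back_substitution[of m y i] inner i by simp
  then have "y i = partial_value \<beta> L v a * fact m / (fact (k - a))\<^sup>2 / fact (m - i)"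
    by (simp only: ym)
  then have "v (a + i - 1) * fact (a + i) / (fact (k - a - i))\<^sup>2
      = partial_value \<beta> L v a * fact m / (fact (k - a))\<^sup>2 / fact (m - i)"
    by (simp only: y_def)
  then show ?thesis by (simp add: field_simps power_divide)
qed

lemma obtain_run:
  fixes L :: "nat set"
  assumes "finite L" "c \<in> L"
  obtains a m i where "{a..<a + m} \<subseteq> L" "a + m \<notin> L" "a = 0 \<or> a - 1 \<notin> L" "1 \<le> i" "i \<le> m" "c = a + i - 1"
    "a \<le> c"
proof -
  define r where "r = run_below L (Suc c)"
  define b where "b = (LEAST b. c < b \<and> b \<notin> L)"
  have "\<exists>b. c < b \<and> b \<notin> L"
    using assms(1) by (metis finite_nat_set_iff_bounded lessI less_not_sym less_trans not_less_eq)
  then have b: "c < b" "b \<notin> L" unfolding b_def by (metis (mono_tags, lifting) LeastI_ex)+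
  have b': "x \<in> L" if "c < x" "x < b" for x
    using not_less_Least[of x "\<lambda>b. c < b \<and> b \<notin> L"] that unfolding b_def by blast
  have r: "1 \<le> r" "r \<le> Suc c" "{Suc c - r..<Suc c} \<subseteq> L" "Suc c - r = 0 \<or> Suc c - r - 1 \<notin> L"
    unfolding r_def using assms(2) run_below_le[of L "Suc c"] run_below_subset[of "Suc c" L] run_below_start[of L "Suc c"]
    by (simp_all del: run_below.simps add: Suc_le_eq) (use assms(2) in auto)
  show ?thesis
  proof (rule that[of "Suc c - r" "b - (Suc c - r)" r])
    have e: "Suc c - r + (b - (Suc c - r)) = b" using b by simp
    show "{Suc c - r..<Suc c - r + (b - (Suc c - r))} \<subseteq> L"
      unfolding e
    proof
      fix x assume "x \<in> {Suc c - r..<b}"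
      then show "x \<in> L" using r(3) b'[of x] by (cases "c < x") auto
    qed
    show "Suc c - r + (b - (Suc c - r)) \<notin> L" unfolding e by (rule b)
  qed (use r b in auto)
qed

text \<open>By induction all unknowns below a run vanish; then \<open>partial_value\<close> is 0 at
  its start, and the explicit solution is 0 on the run.\<close>

lemma limit_system_kernel:
  assumes L: "L \<subseteq> {..<k}"
    and eqs: "\<And>l. l \<in> L \<Longrightarrow> (\<Sum>c\<in>L. scaled_entry k L l (Suc c) 0 * v c) = 0" and "c \<in> L"
  shows "v c = 0"
  using \<open>c \<in> L\<close>
proof (induction c rule: less_induct)
  case (less c)
  have fin: "finite L" using L finite_subset by blast
  obtain a m i where run: "{a..<a + m} \<subseteq> L" "a + m \<notin> L" "a = 0 \<or> a - 1 \<notin> L" "1 \<le> i" "i \<le> m" "c = a + i - 1" "a \<le> c"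
    using obtain_run[OF fin less.prems] .
  have "pred_term L v a = 0"
    unfolding pred_term_def by (rule sum.neutral) (use less.IH run(7) in auto)
  then have "partial_value 0 L v a = 0" by (simp add: partial_value_def)
  then show ?case using run_solution[OF L run(1-3) _ run(4,5), of v 0] eqs run(6) by simp
qed

text \<open>The last hypothesis excludes interior points of runs. From \<open>x\<close> the
  induction goes down across the gap to \<open>b\<close>, then across the run below it to its start
  \<open>a\<close>.\<close>

lemma partial_value_eq_leading_const:
  assumes L: "L \<subseteq> {..<k}"
    and eqs: "\<And>l. l \<in> L \<Longrightarrow> (\<Sum>c\<in>L. scaled_entry k L l (Suc c) 0 * v c) = - of_bool (rank_below L l = 0)"
    and "x \<le> k" "x = 0 \<or> x - 1 \<notin> L \<or> x \<notin> L"
  shows "partial_value 1 L v x = leading_const k L x"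
  using assms(3,4)
proof (induction x rule: less_induct)
  case (less x)
  have fin: "finite L" using L finite_subset by blast
  define g where "g = run_below (- L) x"
  define b where "b = x - g"
  have g: "g \<le> x" unfolding g_def by (rule run_below_le)
  then have x: "x = b + g" by (simp add: b_def)
  have gap: "{b..<b + g} \<inter> L = {}"
    using run_below_subset[of x "- L"] g by (auto simp: b_def g_def)
  have b: "b = 0 \<or> b - 1 \<in> L"
    using run_below_start[of "- L" x, folded g_def] g by (cases "g = x") (auto simp: b_def)
  note lg = leading_const_gap[OF gap b, of k]
  show ?case
  proof (cases "b = 0")
    case True
    then have "L \<inter> {..<x} = {}" using gap x by auto
    then show ?thesis using lg True x pred_term_0[of L x v] by (simp add: partial_value_def rank_below_eq_0_iff)
  next
    case False
    then have bL: "b - 1 \<in> L" using b by simp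
    have bnL: "b \<notin> L"
    proof (cases "g = 0")
      case True
      then show ?thesis using less.prems(2) bL x False by auto
    next
      case False
      then have "b \<in> {b..<b + g}" by simp
      then show ?thesis using gap by blast
    qed
    define m where "m = run_below L b"
    define a where "a = b - m"
    have m: "m \<le> b" unfolding m_def by (rule run_below_le)
    have m1: "1 \<le> m" unfolding m_def using bL False by (cases b) auto
    have ba: "b = a + m" using m by (simp add: a_def)
    have run: "{a..<a + m} \<subseteq> L" "a + m \<notin> L" "a = 0 \<or> a - 1 \<notin> L"
      using run_below_subset[of b L] run_below_start[of L b] bnL m by (auto simp: a_def m_def simp flip: ba)
    have ax: "a < x" using x ba m1 by simp
    have bk: "a + m \<le> k" using x ba less.prems by simp
    have "partial_value 1 L v a = leading_const k L a"
      using less.IH[OF ax] ax less.prems run(3) by auto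
    \<comment> \<open>Only the last unknown of the run, \<open>i = m\<close>, feeds into the
      predecessor term of \<open>x\<close>.\<close>
    then have vb: "v (a + m - 1) = leading_const k L a * fact m * (fact (k - a - m) / fact (k - a))\<^sup>2 / fact (a + m)"
      using run_solution[OF L run, of v 1 m] eqs m1 by simp
    also have "\<dots> = leading_const k L b / fact b"
      using leading_const_run[OF run(1,3) bk] ba by simp
    finally have v: "v (b - 1) = leading_const k L b / fact b" using ba by simp
    have "L \<inter> {Suc (b - 1)..<x} = {}" using gap x False by auto
    then have "pred_term L v x = fact x / fact (x - b) * v (b - 1)"
      using pred_term_eq[OF bL, of x v] x False by simp
    also have "\<dots> = leading_const k L b * real (x choose b)"
      unfolding v using x by (simp add: binomial_fact mult_ac)
    moreover have "rank_below L x \<noteq> 0" using bL x False by (auto simp: rank_below_eq_0_iff)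
    ultimately show ?thesis using lg x by (simp add: partial_value_def)
  qed
qed

lemma limit_solution_pos:
  assumes L: "L \<subseteq> {..<k}"
    and eqs: "\<And>l. l \<in> L \<Longrightarrow> (\<Sum>c\<in>L. scaled_entry k L l (Suc c) 0 * v c) = - of_bool (rank_below L l = 0)"
    and c: "c \<in> L"
  shows "0 < v c"
proof -
  have fin: "finite L" using L finite_subset by blast
  obtain a m i where run: "{a..<a + m} \<subseteq> L" "a + m \<notin> L" "a = 0 \<or> a - 1 \<notin> L" "1 \<le> i" "i \<le> m" "c = a + i - 1" "a \<le> c"
    using obtain_run[OF fin c] .
  have "a \<le> k" using run(7) c L by auto
  then have "partial_value 1 L v a = leading_const k L a" "0 < leading_const k L a"
    using partial_value_eq_leading_const[OF L eqs, of a] run(3) leading_const_pos by auto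
  then show ?thesis using run_solution[OF L run(1-3) _ run(4,5), of v 1] eqs run(6) by simp
qed

text \<open>Row \<open>k\<close> starts an empty run, so only its predecessor term remains, which
  \<open>partial_value\<close> evaluates.\<close>

lemma limit_value:
  assumes L: "L \<subseteq> {..<k}"
    and eqs: "\<And>l. l \<in> L \<Longrightarrow> (\<Sum>c\<in>L. scaled_entry k L l (Suc c) 0 * v c) = - of_bool (rank_below L l = 0)"
  shows "of_bool (L = {}) + (\<Sum>c\<in>L. scaled_entry k L k (Suc c) 0 * v c) = leading_const k L k"
proof -
  have "(\<Sum>c\<in>L. scaled_entry k L k (Suc c) 0 * v c) = pred_term L v k"
    using row_0[OF L, of k k v] L by auto
  moreover have "partial_value 1 L v k = leading_const k L k"
    by (rule partial_value_eq_leading_const[OF L eqs]) (use L in auto)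
  moreover have "rank_below L k = 0 \<longleftrightarrow> L = {}" using L by (auto simp: rank_below_eq_0_iff)
  ultimately show ?thesis by (simp add: partial_value_def)
qed

section \<open>Asymptotics\<close>

lemma run_below_cong: "(\<And>y. y < x \<Longrightarrow> y \<in> L \<longleftrightarrow> y \<in> L') \<Longrightarrow> run_below L x = run_below L' x"
  by (induction x) auto

lemma leading_const_cong:
  assumes "\<And>y. y < x \<Longrightarrow> y \<in> L \<longleftrightarrow> y \<in> L'"
  shows "leading_const k L x = leading_const k L' x"
  using assms
proof (induction x)
  case (Suc x)
  have "run_below L x = run_below L' x" "run_below (- L) x = run_below (- L') x"
    using Suc.prems by (auto intro!: run_below_cong)
  then show ?case using Suc by simp
qed simp

lemma scaled_entry_differentiable: "scaled_entry k L l j differentiable (at z)"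
  unfolding scaled_entry_def[abs_def]
  by (intro differentiable_sum differentiable_mult differentiable_prod differentiable_diff
      differentiable_power differentiable_const differentiable_ident finite_atMost ballI)

lemma eventually_nhds_0_sequentially:
  "\<forall>\<^sub>F e in nhds 0. P e \<Longrightarrow> \<forall>\<^sub>F n in sequentially. P (1 / real n)"
  by (rule eventually_compose_filterlim[OF _ lim_1_over_n])

lemma eventually_pos_at_0:
  assumes "f differentiable (at (0::real))" "0 < (f 0 :: real)"
  shows "\<forall>\<^sub>F e in nhds 0. 0 < f e"
proof -
  have "isCont f 0" using assms(1) by (auto simp: real_differentiable_def DERIV_isCont)
  then have "(f \<longlongrightarrow> f 0) (nhds 0)" by (simp add: tendsto_nhds_iff isCont_def)
  then show ?thesis using assms(2) by (rule order_tendstoD)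
qed

lemma dual_poly_exists:
  assumes L: "L \<subseteq> {..<k}"
  obtains g c where "g differentiable (at 0)" "g 0 = leading_const k L k"
    "\<forall>\<^sub>F n in sequentially. (\<forall>j\<in>Suc ` L. 0 \<le> c n j) \<and>
       (\<forall>l\<in>L. dual_poly n k (Suc ` L) (c n) l = 0) \<and>
       dual_poly n k (Suc ` L) (c n) k = real n ^ card L * g (1 / real n)"
proof -
  have fin: "finite L" using L finite_subset by blast
  \<comment> \<open>Identity rows and columns outside \<open>L\<close> pad the system to size
    \<open>k\<close> without changing the equations for \<open>L\<close>.\<close>
  define A where "A e l c = (if l \<in> L \<and> c \<in> L then scaled_entry k L l (Suc c) e else of_bool (l = c))" for e l c
  \<comment> \<open>The constant 1 of \<open>N(l)\<close>, divided by its power of \<open>n\<close>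
    and moved to the right-hand side.\<close>
  define b where "b e l = (if l \<in> L then - (e ^ rank_below L l) else 0)" for e :: real and l
  have A_row: "(\<Sum>c<k. A e l c * v c) = (\<Sum>c\<in>L. scaled_entry k L l (Suc c) e * v c)" if "l \<in> L" for e l v
    by (rule sum.mono_neutral_cong_right) (use L that in \<open>auto simp: A_def\<close>)
  have A_row': "(\<Sum>c<k. A e l c * v c) = v l" if "l \<notin> L" "l < k" for e l v
  proof -
    have "(\<Sum>c<k. A e l c * v c) = (\<Sum>c<k. if l = c then v l else 0)"
      by (rule sum.cong) (use that in \<open>auto simp: A_def\<close>)
    then show ?thesis using that by simp
  qed
  obtain x where x: "\<And>j. j < k \<Longrightarrow> (\<lambda>e. x e j) differentiable (at 0)"
    "\<forall>\<^sub>F e in nhds 0. \<forall>i<k. (\<Sum>j<k. A e i j * x e j) = b e i"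
  proof (rule linear_system_perturbation[of k A 0 b])
    fix i j assume "i < k" "j < k"
    show "(\<lambda>e. A e i j) differentiable (at 0)"
      unfolding A_def using scaled_entry_differentiable[of k L i "Suc j" 0] by (cases "i \<in> L \<and> j \<in> L") auto
  next
    fix i assume "i < k"
    show "(\<lambda>e. b e i) differentiable (at 0)"
      unfolding b_def by (cases "i \<in> L") (auto intro!: differentiable_minus differentiable_power)
  next
    fix v j assume v: "\<And>i. i < k \<Longrightarrow> (\<Sum>j<k. A 0 i j * v j) = 0" and j: "j < k"
    show "v j = 0"
    proof (cases "j \<in> L")
      case True
      show ?thesis
      proof (rule limit_system_kernel[OF L _ True])
        fix l assume "l \<in> L"
        then show "(\<Sum>c\<in>L. scaled_entry k L l (Suc c) 0 * v c) = 0"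
          using v[of l] A_row[of l 0 v] L by auto
      qed
    next
      case False
      then show ?thesis using v[OF j] A_row'[OF _ j] by simp
    qed
  qed blast
  have sol: "\<forall>\<^sub>F e in nhds 0. \<forall>l\<in>L. (\<Sum>c\<in>L. scaled_entry k L l (Suc c) e * x e c) = - (e ^ rank_below L l)"
    using x(2)
  proof eventually_elim
    case (elim e)
    show ?case
    proof
      fix l assume "l \<in> L"
      then show "(\<Sum>c\<in>L. scaled_entry k L l (Suc c) e * x e c) = - (e ^ rank_below L l)"
        using elim A_row[of l e "x e"] L by (auto simp: b_def)
    qed
  qed
  \<comment> \<open>An eventual property in \<open>nhds 0\<close> holds at 0 too, so
    \<open>x 0\<close> solves the limit system.\<close>
  have sol0: "(\<Sum>c\<in>L. scaled_entry k L l (Suc c) 0 * x 0 c) = - of_bool (rank_below L l = 0)" if "l \<in> L" for l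
    using eventually_nhds_x_imp_x[OF sol] that by (simp add: power_0_left)
  have "\<forall>\<^sub>F e in nhds 0. \<forall>c\<in>L. 0 < x e c"
    using fin
  proof (rule eventually_ball_finite, intro ballI)
    fix c assume c: "c \<in> L"
    then show "\<forall>\<^sub>F e in nhds 0. 0 < x e c"
      using x(1)[of c] L limit_solution_pos[OF L sol0 c] by (intro eventually_pos_at_0) auto
  qed
  then have ev: "\<forall>\<^sub>F e in nhds 0. (\<forall>c\<in>L. 0 < x e c) \<and>
     (\<forall>l\<in>L. (\<Sum>c\<in>L. scaled_entry k L l (Suc c) e * x e c) = - (e ^ rank_below L l))"
    using sol by (rule eventually_conj)
  define g where "g e = e ^ card L + (\<Sum>c\<in>L. scaled_entry k L k (Suc c) e * x e c)" for e
  \<comment> \<open>Undoes the scaling of the unknowns; \<open>x\<close> is indexed by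
    \<open>j - 1\<close> since the support is \<open>Suc\<close> applied to
    \<open>L\<close>.\<close>
  define C where "C n j = x (1 / real n) (j - 1) * real n ^ rank_below L j / real n ^ j" for n j
  show ?thesis
  proof
    show "g differentiable (at 0)"
      unfolding g_def[abs_def]
      by (intro differentiable_add differentiable_sum differentiable_mult x(1) scaled_entry_differentiable
          differentiable_power differentiable_ident fin ballI) (use L in auto)
    show "g 0 = leading_const k L k"
    proof -
      have "(0::real) ^ card L = of_bool (L = {})" using fin by (simp add: power_0_left)
      then show ?thesis using limit_value[OF L sol0] unfolding g_def by (simp only:)
    qed
    have dual: "dual_poly n k (Suc ` L) (C n) l = real n ^ rank_below L l *
       ((1 / real n) ^ rank_below L l + (\<Sum>c\<in>L. scaled_entry k L l (Suc c) (1 / real n) * x (1 / real n) c))"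
      if n: "0 < n" for n l
    proof -
      have "C n (Suc c) * johnson_poly n k (Suc c) l =
          real n ^ rank_below L l * (scaled_entry k L l (Suc c) (1 / real n) * x (1 / real n) c)" for c
      proof -
        have "C n (Suc c) * johnson_poly n k (Suc c) l = x (1 / real n) c / real n ^ Suc c *
            (johnson_poly n k (Suc c) l * real n ^ rank_below L (Suc c))"
          by (simp add: C_def)
        also have "\<dots> = x (1 / real n) c / real n ^ Suc c *
            (real n ^ Suc c * (scaled_entry k L l (Suc c) (1 / real n) * real n ^ rank_below L l))"
          unfolding johnson_poly_eq_scaled_entry[OF n] power_add by (simp only: mult_ac)
        finally show ?thesis using n by simp
      qed
      then have "dual_poly n k (Suc ` L) (C n) l =
         1 + real n ^ rank_below L l * (\<Sum>c\<in>L. scaled_entry k L l (Suc c) (1 / real n) * x (1 / real n) c)"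
        unfolding dual_poly_def by (simp add: sum.reindex sum_distrib_left)
      then show ?thesis using n by (simp add: distrib_left power_one_over)
    qed
    have "L \<inter> {..<k} = L" using L by auto
    then have rk: "rank_below L k = card L" by (simp add: rank_below_def)
    show "\<forall>\<^sub>F n in sequentially. (\<forall>j\<in>Suc ` L. 0 \<le> C n j) \<and>
       (\<forall>l\<in>L. dual_poly n k (Suc ` L) (C n) l = 0) \<and>
       dual_poly n k (Suc ` L) (C n) k = real n ^ card L * g (1 / real n)"
      using eventually_nhds_0_sequentially[OF ev] eventually_gt_at_top[of 0]
    proof eventually_elim
      case (elim n)
      then show ?case
        unfolding dual[OF elim(2)] rk g_def
        by (auto simp: C_def intro!: divide_nonneg_nonneg mult_nonneg_nonneg less_imp_le)
    qed
  qed
qed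

section \<open>From differentiability at 0 to error bounds for all \<open>n > k\<close>\<close>

lemma differentiable_at_0_rate:
  fixes f :: "real \<Rightarrow> real"
  assumes "f differentiable (at 0)"
  obtains C where "0 \<le> C" "\<forall>\<^sub>F n in sequentially. \<bar>f (1 / real n) - f 0\<bar> \<le> C / real n"
proof -
  obtain D where "(f has_real_derivative D) (at 0)" using assms by (auto simp: real_differentiable_def)
  then have "((\<lambda>h. (f (0 + h) - f 0) / h) \<longlongrightarrow> D) (at 0)" by (simp add: DERIV_def)
  then have "\<forall>\<^sub>F h in at 0. dist ((f (0 + h) - f 0) / h) D < 1" by (rule tendstoD) simp
  then have "\<forall>\<^sub>F h in nhds 0. h \<noteq> 0 \<longrightarrow> dist ((f (0 + h) - f 0) / h) D < 1"
    by (simp add: eventually_at_filter)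
  then have ev: "\<forall>\<^sub>F n in sequentially. 1 / real n \<noteq> 0 \<longrightarrow> dist ((f (0 + 1 / real n) - f 0) / (1 / real n)) D < 1"
    by (rule eventually_nhds_0_sequentially)
  show ?thesis
  proof
    show "0 \<le> \<bar>D\<bar> + 1" by simp
    show "\<forall>\<^sub>F n in sequentially. \<bar>f (1 / real n) - f 0\<bar> \<le> (\<bar>D\<bar> + 1) / real n"
      using ev eventually_gt_at_top[of 0]
    proof eventually_elim
      case (elim n)
      then have "\<bar>(f (1 / real n) - f 0) * real n - D\<bar> < 1" by (simp add: dist_real_def)
      then have "\<bar>(f (1 / real n) - f 0) * real n\<bar> \<le> \<bar>D\<bar> + 1" by linarith
      then have "\<bar>f (1 / real n) - f 0\<bar> * real n \<le> \<bar>D\<bar> + 1" by (simp only: abs_mult abs_of_nat)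
      then show ?case using elim by (simp add: pos_le_divide_eq)
    qed
  qed
qed

lemma eventually_bound_imp_bound:
  fixes a w :: "nat \<Rightarrow> real"
  assumes ev: "\<forall>\<^sub>F n in sequentially. a n \<le> C * w n" and w: "\<And>n. k < n \<Longrightarrow> 1 \<le> w n"
  shows "\<exists>c. \<forall>n>k. a n \<le> c * w n"
proof -
  obtain N where N: "\<And>n. N \<le> n \<Longrightarrow> a n \<le> C * w n" using ev by (auto simp: eventually_sequentially)
  \<comment> \<open>The sum absorbs the finitely many exceptions \<open>n < N\<close>, because
    \<open>w n\<close> is at least 1.\<close>
  show ?thesis
  proof (intro exI[of _ "\<bar>C\<bar> + (\<Sum>i<N. \<bar>a i\<bar>)"] allI impI)
    fix n assume "k < n"
    then have w1: "1 \<le> w n" by (rule w)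
    have S: "0 \<le> (\<Sum>i<N. \<bar>a i\<bar>)" by (simp add: sum_nonneg)
    show "a n \<le> (\<bar>C\<bar> + (\<Sum>i<N. \<bar>a i\<bar>)) * w n"
    proof (cases "N \<le> n")
      case True
      have "a n \<le> C * w n" using N True by blast
      also have "\<dots> \<le> (\<bar>C\<bar> + (\<Sum>i<N. \<bar>a i\<bar>)) * w n"
        by (rule mult_right_mono) (use w1 S in linarith)+
      finally show ?thesis .
    next
      case False
      then have "\<bar>a n\<bar> \<le> (\<Sum>i<N. \<bar>a i\<bar>)" by (intro member_le_sum) auto
      then have "a n \<le> \<bar>C\<bar> + (\<Sum>i<N. \<bar>a i\<bar>)" by linarith
      also have "\<dots> = (\<bar>C\<bar> + (\<Sum>i<N. \<bar>a i\<bar>)) * 1" by simp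
      also have "\<dots> \<le> (\<bar>C\<bar> + (\<Sum>i<N. \<bar>a i\<bar>)) * w n"
        using w1 S by (intro mult_left_mono) auto
      finally show ?thesis .
    qed
  qed
qed

text \<open>For \<open>s = 0\<close> the exponent \<open>s - 1\<close> is truncated to 0 and the
  claim is \<open>1 / n \<le> 1\<close>.\<close>

lemma power_div_le: "0 < n \<Longrightarrow> real n ^ s / real n \<le> real n ^ (s - 1)"
  by (cases s) auto

text \<open>Differentiability makes both bounds deviate from \<open>K\<close> by O(1/n). For the
  order of growth, continuity suffices: near 0 the bounds lie between \<open>K / 2\<close> and
  \<open>2 * K\<close>.\<close>

lemma asymptotics_from_bounds:
  fixes t :: "nat \<Rightarrow> real"
  assumes lo: "lo differentiable (at 0)" "lo 0 = K" and up: "up differentiable (at 0)" "up 0 = K"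
    and K: "0 < K"
    and ev: "\<forall>\<^sub>F n in sequentially. real n ^ s * lo (1 / real n) \<le> t n \<and> t n \<le> real n ^ s * up (1 / real n)"
  shows "(\<exists>c. \<forall>n>k. t n \<ge> K * real n ^ s - c * real n ^ (s - 1)) \<and>
    (\<exists>C. \<forall>n>k. t n \<le> K * real n ^ s + C * real n ^ (s - 1)) \<and> t \<in> \<Theta>(\<lambda>n. real n ^ s)"
proof (intro conjI)
  have w: "k < n \<Longrightarrow> 1 \<le> real n ^ (s - 1)" for n by simp
  have err: "C * (real n ^ s / real n) \<le> C * real n ^ (s - 1)" if "0 \<le> C" "0 < n" for C n
    using power_div_le that by (intro mult_left_mono)
  obtain C where C: "0 \<le> C" "\<forall>\<^sub>F n in sequentially. \<bar>lo (1 / real n) - lo 0\<bar> \<le> C / real n"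
    using differentiable_at_0_rate[OF lo(1)] .
  have "\<forall>\<^sub>F n in sequentially. K * real n ^ s - t n \<le> C * real n ^ (s - 1)"
    using C(2) ev eventually_gt_at_top[of 0]
  proof eventually_elim
    case (elim n)
    have "real n ^ s * (K - C / real n) \<le> real n ^ s * lo (1 / real n)"
      using elim(1) lo(2) by (intro mult_left_mono) auto
    then show ?case using elim err[OF C(1), of n] by (simp add: algebra_simps)
  qed
  from eventually_bound_imp_bound[OF this w]
  obtain c where "\<forall>n>k. K * real n ^ s - t n \<le> c * real n ^ (s - 1)" by blast
  then show "\<exists>c. \<forall>n>k. t n \<ge> K * real n ^ s - c * real n ^ (s - 1)"
    by (intro exI[of _ c]) (simp add: algebra_simps)
next
  have w: "k < n \<Longrightarrow> 1 \<le> real n ^ (s - 1)" for n by simp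
  have err: "C * (real n ^ s / real n) \<le> C * real n ^ (s - 1)" if "0 \<le> C" "0 < n" for C n
    using power_div_le that by (intro mult_left_mono)
  obtain C where C: "0 \<le> C" "\<forall>\<^sub>F n in sequentially. \<bar>up (1 / real n) - up 0\<bar> \<le> C / real n"
    using differentiable_at_0_rate[OF up(1)] .
  have "\<forall>\<^sub>F n in sequentially. t n - K * real n ^ s \<le> C * real n ^ (s - 1)"
    using C(2) ev eventually_gt_at_top[of 0]
  proof eventually_elim
    case (elim n)
    have "real n ^ s * up (1 / real n) \<le> real n ^ s * (K + C / real n)"
      using elim(1) up(2) by (intro mult_left_mono) auto
    then show ?case using elim err[OF C(1), of n] by (simp add: algebra_simps)
  qed
  from eventually_bound_imp_bound[OF this w]
  obtain c where "\<forall>n>k. t n - K * real n ^ s \<le> c * real n ^ (s - 1)" by blast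
  then show "\<exists>C. \<forall>n>k. t n \<le> K * real n ^ s + C * real n ^ (s - 1)"
    by (intro exI[of _ c]) (simp add: algebra_simps)
next
  have "\<forall>\<^sub>F e in nhds 0. 0 < lo e - K / 2" "\<forall>\<^sub>F e in nhds 0. 0 < 2 * K - up e"
    using eventually_pos_at_0[of "\<lambda>e. lo e - K / 2"] eventually_pos_at_0[of "\<lambda>e. 2 * K - up e"] lo up K
    by simp_all
  then have "\<forall>\<^sub>F e in nhds 0. 0 < lo e - K / 2 \<and> 0 < 2 * K - up e" by (rule eventually_conj)
  then have "\<forall>\<^sub>F n in sequentially. 0 < lo (1 / real n) - K / 2 \<and> 0 < 2 * K - up (1 / real n)"
    by (rule eventually_nhds_0_sequentially)
  then have "\<forall>\<^sub>F n in sequentially. K / 2 * real n ^ s \<le> t n \<and> t n \<le> 2 * K * real n ^ s"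
    using ev
  proof eventually_elim
    case (elim n)
    have "real n ^ s * (K / 2) \<le> real n ^ s * lo (1 / real n)"
      using elim by (intro mult_left_mono) auto
    moreover have "real n ^ s * up (1 / real n) \<le> real n ^ s * (2 * K)"
      using elim by (intro mult_left_mono) auto
    ultimately show ?case using elim by (simp add: mult.commute)
  qed
  then have "\<forall>\<^sub>F n in sequentially. K / 2 * norm (real n ^ s) \<le> norm (t n) \<and>
    norm (t n) \<le> 2 * K * norm (real n ^ s)"
  proof eventually_elim
    case (elim n)
    have "0 \<le> K / 2 * real n ^ s" using K by simp
    then have "0 \<le> t n" using elim by linarith
    then show ?case using elim by simp
  qed
  then have b: "\<forall>\<^sub>F n in sequentially. K / 2 * norm (real n ^ s) \<le> norm (t n)"
    "\<forall>\<^sub>F n in sequentially. norm (t n) \<le> 2 * K * norm (real n ^ s)"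
    by (simp_all add: eventually_conj_iff)
  show "t \<in> \<Theta>(\<lambda>n. real n ^ s)"
    by (intro bigthetaI bigoI[OF b(2)] landau_omega.bigI[OF _ b(1)]) (use K in simp)
qed

lemma choose_eq_power_mult:
  assumes "0 < n"
  shows "real (n choose k) = real n ^ k * ((\<Prod>t<k. 1 - real t * (1 / real n)) / fact k)"
proof -
  have "real n ^ k * (\<Prod>t<k. 1 - real t * (1 / real n)) = (\<Prod>t<k. real n * (1 - real t * (1 / real n)))"
    by (simp add: prod.distrib)
  also have "\<dots> = (\<Prod>t<k. real n - real t)"
    using assms by (intro prod.cong refl) (simp add: field_simps)
  finally show ?thesis by (simp add: binomial_gbinomial gbinomial_prod_rev lessThan_atLeast0)
qed

theorem theorem1:
  fixes k :: nat and L :: "nat set"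
  assumes "0 < k" and "L \<subseteq> {0..k - 1}"
  shows "(\<exists>c::real. \<forall>n>k. theta_johnson n k L \<ge>
            K_const k L * real n ^ card L - c * real n ^ (card L - 1))
       \<and> (\<exists>C::real. \<forall>n>k. theta_johnson n k L \<le>
            K_const k L * real n ^ card L + C * real n ^ (card L - 1))
       \<and> (\<lambda>n. theta_johnson n k L) \<in> \<Theta>(\<lambda>n. real n ^ card L)"
proof -
  have L: "L \<subseteq> {..<k}" using assms by fastforce
  define M where "M = {..<k} - L"
  have M: "M \<subseteq> {..<k}" by (auto simp: M_def)
  have card: "card L + card M = k"
    using L card_mono[OF _ L] by (simp add: M_def card_Diff_subset finite_subset)
  obtain up c where up: "up differentiable (at 0)" "up 0 = leading_const k L k"
    "\<forall>\<^sub>F n in sequentially. (\<forall>j\<in>Suc ` L. 0 \<le> c n j) \<and>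
       (\<forall>l\<in>L. dual_poly n k (Suc ` L) (c n) l = 0) \<and>
       dual_poly n k (Suc ` L) (c n) k = real n ^ card L * up (1 / real n)"
    using dual_poly_exists[OF L] .
  obtain g d where g: "g differentiable (at 0)" "g 0 = leading_const k M k"
    "\<forall>\<^sub>F n in sequentially. (\<forall>j\<in>Suc ` M. 0 \<le> d n j) \<and>
       (\<forall>l\<in>M. dual_poly n k (Suc ` M) (d n) l = 0) \<and>
       dual_poly n k (Suc ` M) (d n) k = real n ^ card M * g (1 / real n)"
    using dual_poly_exists[OF M] .
  have posL: "0 < leading_const k L k" and posM: "0 < leading_const k M k" by (auto intro: leading_const_pos)
  \<comment> \<open>Only membership below \<open>k\<close> matters, so the complement in
    \<open>{..<k}\<close> may be replaced by \<open>- L\<close>.\<close>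
  have "leading_const k M k = leading_const k (- L) k" by (rule leading_const_cong) (auto simp: M_def)
  then have dual: "leading_const k L k * leading_const k M k = 1 / fact k"
    using leading_const_mult_compl[of k k L] by (simp add: power2_eq_square)
  have gpos: "\<forall>\<^sub>F n in sequentially. 0 < g (1 / real n)"
    using eventually_pos_at_0[OF g(1)] g(2) posM by (intro eventually_nhds_0_sequentially) simp
  \<comment> \<open>The lower bound divided by its power of \<open>n\<close>: the product over
    \<open>fact k\<close> is \<open>n choose k\<close> divided by \<open>n ^ k\<close>. At 0 it is
    the inverse of \<open>fact k\<close> times the constant for \<open>M\<close>, hence the constant
    for \<open>L\<close>.\<close>
  define lo where "lo e = (\<Prod>t<k. 1 - real t * e) / fact k / g e" for e :: real
  have "lo differentiable (at 0)"
    unfolding lo_def[abs_def]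
    by (intro differentiable_divide differentiable_prod differentiable_diff differentiable_mult
        differentiable_const differentiable_ident g(1)) (use g(2) posM in auto)
  moreover have "lo 0 = K_const k L"
    using dual posM unfolding lo_def g(2) K_const_eq_leading_const[OF L] by (simp add: field_simps)
  moreover have "up 0 = K_const k L" "0 < K_const k L"
    using up(2) posL K_const_eq_leading_const[OF L] by auto
  moreover have "\<forall>\<^sub>F n in sequentially. real n ^ card L * lo (1 / real n) \<le> theta_johnson n k L
     \<and> theta_johnson n k L \<le> real n ^ card L * up (1 / real n)"
    using up(3) g(3) gpos eventually_gt_at_top[of k]
  proof eventually_elim
    case (elim n)
    then have n: "0 < n" by simp
    have "real n ^ card L * lo (1 / real n) = real (n choose k) / dual_poly n k (Suc ` M) (d n) k"
    proof -
      have "real n ^ k = real n ^ card L * real n ^ card M" by (simp add: card flip: power_add)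
      moreover have "dual_poly n k (Suc ` M) (d n) k = real n ^ card M * g (1 / real n)"
        using elim by blast
      ultimately show ?thesis
        unfolding choose_eq_power_mult[OF n] lo_def using n by simp
    qed
    also have "\<dots> \<le> theta_johnson n k L"
    proof (rule theta_johnson_ge[of "Suc ` L" "c n" L n k "Suc ` M" "d n"])
      show "0 < dual_poly n k (Suc ` M) (d n) k" using elim n by simp
    qed (use elim in \<open>auto simp: M_def\<close>)
    finally have "real n ^ card L * lo (1 / real n) \<le> theta_johnson n k L" .
    moreover have "theta_johnson n k L \<le> dual_poly n k (Suc ` L) (c n) k"
      by (rule theta_johnson_le) (use elim in auto)
    ultimately show ?case using elim by simp
  qed
  ultimately show ?thesis using up(1) by (intro asymptotics_from_bounds)
qed

end
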